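(* Let $G$ be a compact Lie group, let $\rho: G \to \mathrm{GL}(V)$ be an irreducible finite-dimensional complex representation, and let $W_{l_1},\dots,W_{l_q}: G\to\mathbb{C}$ be a collection of single-argument Wilson loops with respect to $\rho$. Let $\lambda\in\mathbb{C}$ be the eigenvalue of the Casimir, $\rho(C)=\lambda\,\mathrm{id}_V$, and let $n_r$ be the number of factors $g^{\pm1}$ in $W_{l_r}$. Let $\nu_W(g)=\frac1Z\exp\bigl(\beta\sum_pW_p(g)\bigr)$ be the single-argument Wilson action density, where $\beta\in\mathbb R$, $p$ ranges over a finite index set, each $W_p$ has the form $W_p(g)=\mathrm{tr}\,\rho(C_pg^{\pm1})$ with $C_p\in G$, and $Z$ is the normalization factor. Then $$\begin{aligned}\lambda \sum_{r=1}^q n_r \int_G W_{l_1}\cdots W_{l_q}\,\nu_W\,dg ={}& -2\sum_{1\le r<s\le q}\int_G \mathcal{M}(W_{l_r},W_{l_s})\prod_{k\ne r,s}W_{l_k}\,\nu_W\,dg\\&-\sum_{r=1}^q\int_G\mathcal{T}(W_{l_r})\prod_{k\neq r}W_{l_k}\,\nu_W\,dg\\&+\beta\lambda\sum_p\int_GW_p\,W_{l_1}\cdots W_{l_q}\,\nu_W\,dg\\&+\beta^2\sum_{p,p'}\int_G\mathcal M(W_p,W_{p'})\,W_{l_1}\cdots W_{l_q}\,\nu_W\,dg,\end{aligned}$$ where $\mathcal{M}$ denotes the total merger, $\mathcal{T}$ the total twisting, and the last sum runs over all ordered pairs $(p,p')$ (including $p=p'$).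
   Context: Setting: $G$ is a compact Lie group with Lie algebra $\mathfrak g$, $\kappa$ is a fixed $\mathrm{Ad}_G$-invariant positive-definite symmetric bilinear form on $\mathfrak g$, and $\{\xi^a\}$ is a $\kappa$-orthonormal basis of $\mathfrak g$. $dg$ is the normalized Haar measure. $C=\sum_a\xi^a\xi^a\in \mathrm{U}(\mathfrak g)$ is the Casimir invariant. The induced Lie algebra representation is also denoted $\rho$. The normalization factor is $Z=\int_G\exp(\beta\sum_pW_p(g))\,dg$ (taken to be nonzero). Wilson loops: for $l=((c_1,\sigma_1),\dots,(c_n,\sigma_n))\in(G\times\{\pm1\})^n$, the single-argument Wilson loop is $W_l(g)=\mathrm{tr}\,\rho(c_1g^{\sigma_1}c_2g^{\sigma_2}\cdots c_ng^{\sigma_n})$. For positions $a,b\in\{1,\dots,n\}$ put, with indices read cyclically modulo $n$, $$P^l_{a,b}(g)=\rho\bigl(c_{a+1}\,g^{\sigma_{a+1}}\,c_{a+2}\,g^{\sigma_{a+2}}\cdots g^{\sigma_{b-1}}\,c_b\bigr),$$ going once cyclically from $a+1$ to $b$ (a full cycle if $a=b$). Thus $W_l(g)=\mathrm{tr}(P^l_{j,j}(g)\rho(g^{\sigma_j}))$ for every $j$, and $W_l(g)=\mathrm{tr}(P^l_{j',j}(g)\rho(g^{\sigma_j})P^l_{j,j'}(g)\rho(g^{\sigma_{j'}}))$ for $j\ne j'$. Put $X_a^{+1}(g)=\rho(g)\rho(\xi^a)$ and $X_a^{-1}(g)=-\rho(\xi^a)\rho(g^{-1})$. Merging: for loops $l,l'$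 of lengths $n,n'$ (signs $\sigma,\sigma'$), $\mathcal M_{jj'}(W_l,W_{l'})(g)=\sum_a\mathrm{tr}\bigl(P^l_{j,j}(g)X_a^{\sigma_j}(g)\bigr)\,\mathrm{tr}\bigl(P^{l'}_{j',j'}(g)X_a^{\sigma'_{j'}}(g)\bigr)$, and the total merger is $\mathcal M(W_l,W_{l'})=\sum_{j=1}^{n}\sum_{j'=1}^{n'}\mathcal M_{jj'}(W_l,W_{l'})$. Twisting: for $j\ne j'$, $\mathcal T_{jj'}(W_l)(g)=\sum_a\mathrm{tr}\bigl(P^l_{j',j}(g)X_a^{\sigma_j}(g)P^l_{j,j'}(g)X_a^{\sigma_{j'}}(g)\bigr)$, and the total twisting is $\mathcal T(W_l)=\sum_{j\neq j'}\mathcal T_{jj'}(W_l)$, the sum running over ordered pairs of distinct positions. *)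

theory Defs
  imports "HOL-Probability.Probability" "HOL-Algebra.Group"
begin

section \<open>Smooth manifolds and smooth maps\<close>

text \<open>
  On an open subset of a finite-dimensional space, continuity of all iterated directional
  derivatives up to order \<open>k\<close> is the usual \<open>C\<^sup>k\<close> condition.
\<close>

primrec Ck_on :: "nat \<Rightarrow> 'a::real_normed_vector set \<Rightarrow> ('a \<Rightarrow> 'b::real_normed_vector) \<Rightarrow> bool" where
  "Ck_on 0 S f \<longleftrightarrow> continuous_on S f"
| "Ck_on (Suc k) S f \<longleftrightarrow> (\<forall>x\<in>S. f differentiable (at x)) \<and>
      (\<forall>v. Ck_on k S (\<lambda>x. frechet_derivative f (at x) v))"

definition smooth_on :: "'a::real_normed_vector set \<Rightarrow> ('a \<Rightarrow> 'b::real_normed_vector) \<Rightarrow> bool" where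
  "smooth_on S f \<longleftrightarrow> (\<forall>k. Ck_on k S f)"

text \<open>A chart is a pair of an open domain and a coordinate map (relevant on that domain only).\<close>

type_synonym ('m, 'e) atlas = "('m set \<times> ('m \<Rightarrow> 'e)) set"

text \<open>
  The model space is an arbitrary finite-dimensional normed space instead of a type of class
  \<open>euclidean_space\<close>, because the latter excludes dimension 0, i.e. finite groups.
\<close>

definition smooth_atlas ::
    "('m::{t2_space,second_countable_topology}, 'e::real_normed_vector) atlas \<Rightarrow> bool" where
  "smooth_atlas A \<longleftrightarrow>
     (\<exists>B::'e set. finite B \<and> span B = UNIV) \<and>
     (\<forall>(U, \<phi>)\<in>A. open U \<and> open (\<phi> ` U) \<and> homeomorphism U (\<phi> ` U) \<phi> (inv_into U \<phi>)) \<and>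
     (\<Union>(U, \<phi>)\<in>A. U) = UNIV \<and>
     (\<forall>(U, \<phi>)\<in>A. \<forall>(V, \<psi>)\<in>A. smooth_on (\<phi> ` (U \<inter> V)) (\<psi> \<circ> inv_into U \<phi>))"

definition smooth_map ::
    "('m::topological_space, 'd::real_normed_vector) atlas \<Rightarrow>
     ('n::topological_space, 'e::real_normed_vector) atlas \<Rightarrow> ('m \<Rightarrow> 'n) \<Rightarrow> bool" where
  "smooth_map A B f \<longleftrightarrow> continuous_on UNIV f \<and>
     (\<forall>(U, \<phi>)\<in>A. \<forall>(V, \<psi>)\<in>B. smooth_on (\<phi> ` (U \<inter> f -` V)) (\<psi> \<circ> f \<circ> inv_into U \<phi>))"

definition prod_atlas :: "('m, 'd) atlas \<Rightarrow> ('n, 'e) atlas \<Rightarrow> ('m \<times> 'n, 'd \<times> 'e) atlas" where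
  "prod_atlas A B = {(U \<times> V, map_prod \<phi> \<psi>) | U \<phi> V \<psi>. (U, \<phi>) \<in> A \<and> (V, \<psi>) \<in> B}"

definition vector_space_atlas :: "('v, 'v) atlas" where
  "vector_space_atlas = {(UNIV, id)}"

section \<open>Compact Lie groups, their Lie algebras and Haar measure\<close>

text \<open>The underlying manifold of the group is the whole topological type \<open>'g\<close>.\<close>

definition compact_lie_group ::
    "('g::{t2_space,second_countable_topology}) monoid \<Rightarrow>
     ('g, 'e::real_normed_vector) atlas \<Rightarrow> bool" where
  "compact_lie_group G A \<longleftrightarrow>
     group G \<and> carrier G = UNIV \<and> compact (UNIV :: 'g set) \<and> smooth_atlas A \<and>
     smooth_map (prod_atlas A A) A (\<lambda>(x, y). x \<otimes>\<^bsub>G\<^esub> y) \<and>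
     smooth_map A A (\<lambda>x. inv\<^bsub>G\<^esub> x)"

definition smooth_functions ::
    "('g::topological_space, 'e::real_normed_vector) atlas \<Rightarrow> ('g \<Rightarrow> real) set" where
  "smooth_functions A = {f. smooth_map A vector_space_atlas f}"

type_synonym 'g vector_field = "('g \<Rightarrow> real) \<Rightarrow> 'g \<Rightarrow> real"

text \<open>
  The Lie algebra consists of the left-invariant vector fields, i.e. the derivations of the
  algebra of smooth functions which commute with left translations.  A vector field is set to 0
  outside the smooth functions, so that it is determined by its action on these and so that the
  pointwise operations make the Lie algebra a real vector space.
\<close>

definition lie_algebra ::
    "('g::topological_space) monoid \<Rightarrow> ('g, 'e::real_normed_vector) atlas \<Rightarrow> 'g vector_field set" where
  "lie_algebra G A = {X.
     (\<forall>f. f \<notin> smooth_functions A \<longrightarrow> X f = (\<lambda>x. 0)) \<and>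
     (\<forall>f\<in>smooth_functions A. X f \<in> smooth_functions A) \<and>
     (\<forall>f\<in>smooth_functions A. \<forall>h\<in>smooth_functions A.
        X (\<lambda>x. f x + h x) = (\<lambda>x. X f x + X h x)) \<and>
     (\<forall>c. \<forall>f\<in>smooth_functions A. X (\<lambda>x. c * f x) = (\<lambda>x. c * X f x)) \<and>
     (\<forall>f\<in>smooth_functions A. \<forall>h\<in>smooth_functions A.
        X (\<lambda>x. f x * h x) = (\<lambda>x. X f x * h x + f x * X h x)) \<and>
     (\<forall>a. \<forall>f\<in>smooth_functions A. X (\<lambda>x. f (a \<otimes>\<^bsub>G\<^esub> x)) = (\<lambda>x. X f (a \<otimes>\<^bsub>G\<^esub> x)))}"

text \<open>
  \<open>Ad g X\<close> is the push-forward of \<open>X\<close> along the conjugation \<open>y \<mapsto> g y g\<^sup>-\<^sup>1\<close>; at the identity this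
  is the differential of the conjugation applied to the tangent vector of \<open>X\<close>.
\<close>

definition Ad :: "'g monoid \<Rightarrow> 'g \<Rightarrow> 'g vector_field \<Rightarrow> 'g vector_field" where
  "Ad G g X = (\<lambda>f x. X (\<lambda>y. f (g \<otimes>\<^bsub>G\<^esub> y \<otimes>\<^bsub>G\<^esub> inv\<^bsub>G\<^esub> g)) (inv\<^bsub>G\<^esub> g \<otimes>\<^bsub>G\<^esub> x \<otimes>\<^bsub>G\<^esub> g))"

definition Ad_invariant_inner_product ::
    "('g::topological_space) monoid \<Rightarrow> ('g, 'e::real_normed_vector) atlas \<Rightarrow>
     ('g vector_field \<Rightarrow> 'g vector_field \<Rightarrow> real) \<Rightarrow> bool" where
  "Ad_invariant_inner_product G A \<kappa> \<longleftrightarrow>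
     (\<forall>X\<in>lie_algebra G A. \<forall>Y\<in>lie_algebra G A. \<kappa> X Y = \<kappa> Y X) \<and>
     (\<forall>X\<in>lie_algebra G A. \<forall>Y\<in>lie_algebra G A. \<forall>Y'\<in>lie_algebra G A.
        \<kappa> X (\<lambda>f x. Y f x + Y' f x) = \<kappa> X Y + \<kappa> X Y') \<and>
     (\<forall>c. \<forall>X\<in>lie_algebra G A. \<forall>Y\<in>lie_algebra G A.
        \<kappa> X (\<lambda>f x. c * Y f x) = c * \<kappa> X Y) \<and>
     (\<forall>X\<in>lie_algebra G A. X \<noteq> (\<lambda>f x. 0) \<longrightarrow> \<kappa> X X > 0) \<and>
     (\<forall>g. \<forall>X\<in>lie_algebra G A. \<forall>Y\<in>lie_algebra G A. \<kappa> (Ad G g X) (Ad G g Y) = \<kappa> X Y)"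

text \<open>Linear independence is a consequence of orthonormality.\<close>

definition orthonormal_basis ::
    "('g::topological_space) monoid \<Rightarrow> ('g, 'e::real_normed_vector) atlas \<Rightarrow>
     ('g vector_field \<Rightarrow> 'g vector_field \<Rightarrow> real) \<Rightarrow> 'i set \<Rightarrow> ('i \<Rightarrow> 'g vector_field) \<Rightarrow> bool" where
  "orthonormal_basis G A \<kappa> I \<xi> \<longleftrightarrow>
     finite I \<and> \<xi> ` I \<subseteq> lie_algebra G A \<and>
     (\<forall>a\<in>I. \<forall>b\<in>I. \<kappa> (\<xi> a) (\<xi> b) = (if a = b then 1 else 0)) \<and>
     (\<forall>X\<in>lie_algebra G A. \<exists>c. X = (\<lambda>f x. \<Sum>a\<in>I. c a * \<xi> a f x))"

text \<open>
  Regularity need not be required: it is automatic for finite Borel measures on a compact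
  second-countable Hausdorff space.
\<close>

definition normalized_haar_measure :: "('g::topological_space) monoid \<Rightarrow> 'g measure \<Rightarrow> bool" where
  "normalized_haar_measure G \<mu> \<longleftrightarrow>
     prob_space \<mu> \<and> sets \<mu> = sets borel \<and>
     (\<forall>h. \<forall>S\<in>sets borel. emeasure \<mu> ((\<lambda>x. h \<otimes>\<^bsub>G\<^esub> x) ` S) = emeasure \<mu> S)"

section \<open>Representations\<close>

text \<open>
  A representation on \<open>V = \<complex>\<^sup>n\<close> is given by its matrices; these are invertible since the
  identity of the group is mapped to the identity matrix.
\<close>

definition lie_group_representation ::
    "('g::topological_space) monoid \<Rightarrow> ('g, 'e::real_normed_vector) atlas \<Rightarrow>
     ('g \<Rightarrow> complex^'n^'n) \<Rightarrow> bool" where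
  "lie_group_representation G A \<rho> \<longleftrightarrow>
     \<rho> \<one>\<^bsub>G\<^esub> = mat 1 \<and> (\<forall>x y. \<rho> (x \<otimes>\<^bsub>G\<^esub> y) = \<rho> x ** \<rho> y) \<and>
     smooth_map A vector_space_atlas \<rho>"

definition irreducible_representation :: "('g \<Rightarrow> complex^'n^'n) \<Rightarrow> bool" where
  "irreducible_representation \<rho> \<longleftrightarrow>
     (\<forall>U. vec.subspace U \<and> (\<forall>g. \<forall>v\<in>U. \<rho> g *v v \<in> U) \<longrightarrow> U = {0} \<or> U = UNIV)"

text \<open>
  The induced representation \<open>\<rho>(X) = d\<rho>\<^sub>1(X\<^sub>1)\<close> of the Lie algebra: the real derivation \<open>X\<close>
  is applied to the real and imaginary parts of the matrix entries and evaluated at the identity.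
\<close>

definition induced_rep ::
    "'g monoid \<Rightarrow> ('g \<Rightarrow> complex^'n^'n) \<Rightarrow> 'g vector_field \<Rightarrow> complex^'n^'n" where
  "induced_rep G \<rho> X =
     (\<chi> i j. Complex (X (\<lambda>g. Re (\<rho> g $ i $ j)) \<one>\<^bsub>G\<^esub>) (X (\<lambda>g. Im (\<rho> g $ i $ j)) \<one>\<^bsub>G\<^esub>))"

text \<open>
  The image \<open>\<rho>(C)\<close> of \<open>C = \<Sum>\<^sub>a \<xi>\<^sup>a \<xi>\<^sup>a\<close> under the extension of \<open>\<rho>\<close> to the universal enveloping
  algebra, which sends products to products of operators.
\<close>

definition casimir_rep ::
    "'g monoid \<Rightarrow> ('g \<Rightarrow> complex^'n^'n) \<Rightarrow> 'i set \<Rightarrow> ('i \<Rightarrow> 'g vector_field) \<Rightarrow> complex^'n^'n" where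
  "casimir_rep G \<rho> I \<xi> = (\<Sum>a\<in>I. induced_rep G \<rho> (\<xi> a) ** induced_rep G \<rho> (\<xi> a))"

section \<open>Wilson loops, merging and twisting\<close>

text \<open>Positions in a loop are counted from 0.\<close>

type_synonym 'g loop = "('g \<times> int) list"

definition is_loop :: "'g loop \<Rightarrow> bool" where
  "is_loop l \<longleftrightarrow> (\<forall>(c, \<sigma>)\<in>set l. \<sigma> = 1 \<or> \<sigma> = -1)"

definition loop_word :: "'g monoid \<Rightarrow> 'g loop \<Rightarrow> 'g \<Rightarrow> 'g" where
  "loop_word G l g = foldr (\<lambda>(c, \<sigma>) x. c \<otimes>\<^bsub>G\<^esub> (g [^]\<^bsub>G\<^esub> \<sigma>) \<otimes>\<^bsub>G\<^esub> x) l \<one>\<^bsub>G\<^esub>"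

definition wilson_loop :: "'g monoid \<Rightarrow> ('g \<Rightarrow> complex^'n^'n) \<Rightarrow> 'g loop \<Rightarrow> 'g \<Rightarrow> complex" where
  "wilson_loop G \<rho> l g = trace (\<rho> (loop_word G l g))"

text \<open>
  \<open>P\<^sub>a\<^sub>,\<^sub>b\<close>: the rotated loop starts at position \<open>a + 1\<close>; of it one takes the factors
  \<open>c g\<^sup>\<sigma>\<close> strictly before position \<open>b\<close>, of which there are \<open>b - a - 1\<close> modulo the length
  (all but one if \<open>a = b\<close>), and then \<open>c\<^sub>b\<close>.
\<close>

definition loop_segment ::
    "'g monoid \<Rightarrow> ('g \<Rightarrow> complex^'n^'n) \<Rightarrow> 'g loop \<Rightarrow> nat \<Rightarrow> nat \<Rightarrow> 'g \<Rightarrow> complex^'n^'n" where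
  "loop_segment G \<rho> l a b g =
     \<rho> (loop_word G (take ((b + length l - Suc a) mod length l) (rotate (Suc a) l)) g
        \<otimes>\<^bsub>G\<^esub> fst (l ! b))"

definition insertion ::
    "'g monoid \<Rightarrow> ('g \<Rightarrow> complex^'n^'n) \<Rightarrow> 'g vector_field \<Rightarrow> int \<Rightarrow> 'g \<Rightarrow> complex^'n^'n" where
  "insertion G \<rho> X \<sigma> g =
     (if \<sigma> = 1 then \<rho> g ** induced_rep G \<rho> X else - (induced_rep G \<rho> X ** \<rho> (inv\<^bsub>G\<^esub> g)))"

definition merging_at ::
    "'g monoid \<Rightarrow> ('g \<Rightarrow> complex^'n^'n) \<Rightarrow> 'i set \<Rightarrow> ('i \<Rightarrow> 'g vector_field) \<Rightarrow>
     'g loop \<Rightarrow> 'g loop \<Rightarrow> nat \<Rightarrow> nat \<Rightarrow> 'g \<Rightarrow> complex" where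
  "merging_at G \<rho> I \<xi> l l' j j' g =
     (\<Sum>a\<in>I. trace (loop_segment G \<rho> l j j g ** insertion G \<rho> (\<xi> a) (snd (l ! j)) g) *
             trace (loop_segment G \<rho> l' j' j' g ** insertion G \<rho> (\<xi> a) (snd (l' ! j')) g))"

definition total_merger ::
    "'g monoid \<Rightarrow> ('g \<Rightarrow> complex^'n^'n) \<Rightarrow> 'i set \<Rightarrow> ('i \<Rightarrow> 'g vector_field) \<Rightarrow>
     'g loop \<Rightarrow> 'g loop \<Rightarrow> 'g \<Rightarrow> complex" where
  "total_merger G \<rho> I \<xi> l l' g =
     (\<Sum>j<length l. \<Sum>j'<length l'. merging_at G \<rho> I \<xi> l l' j j' g)"

definition twisting_at ::
    "'g monoid \<Rightarrow> ('g \<Rightarrow> complex^'n^'n) \<Rightarrow> 'i set \<Rightarrow> ('i \<Rightarrow> 'g vector_field) \<Rightarrow>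
     'g loop \<Rightarrow> nat \<Rightarrow> nat \<Rightarrow> 'g \<Rightarrow> complex" where
  "twisting_at G \<rho> I \<xi> l j j' g =
     (\<Sum>a\<in>I. trace (loop_segment G \<rho> l j' j g ** insertion G \<rho> (\<xi> a) (snd (l ! j)) g **
                   loop_segment G \<rho> l j j' g ** insertion G \<rho> (\<xi> a) (snd (l ! j')) g))"

definition total_twisting ::
    "'g monoid \<Rightarrow> ('g \<Rightarrow> complex^'n^'n) \<Rightarrow> 'i set \<Rightarrow> ('i \<Rightarrow> 'g vector_field) \<Rightarrow>
     'g loop \<Rightarrow> 'g \<Rightarrow> complex" where
  "total_twisting G \<rho> I \<xi> l g =
     (\<Sum>j<length l. \<Sum>j'\<in>{..<length l} - {j}. twisting_at G \<rho> I \<xi> l j j' g)"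

section \<open>Wilson action\<close>

text \<open>
  The Wilson loop of the one-element list \<open>[(C p, \<epsilon> p)]\<close> is \<open>W\<^sub>p(g) = tr \<rho>(C\<^sub>p g\<^sup>\<plusminus>\<^sup>1)\<close>.
  The traces are complex valued, hence so are the partition function and the density.
\<close>

definition wilson_weight ::
    "'g monoid \<Rightarrow> ('g \<Rightarrow> complex^'n^'n) \<Rightarrow> real \<Rightarrow>
     'p set \<Rightarrow> ('p \<Rightarrow> 'g) \<Rightarrow> ('p \<Rightarrow> int) \<Rightarrow> 'g \<Rightarrow> complex" where
  "wilson_weight G \<rho> \<beta> P C \<epsilon> g = exp (of_real \<beta> * (\<Sum>p\<in>P. wilson_loop G \<rho> [(C p, \<epsilon> p)] g))"

definition wilson_partition_function ::
    "'g monoid \<Rightarrow> ('g \<Rightarrow> complex^'n^'n) \<Rightarrow> 'g measure \<Rightarrow> real \<Rightarrow>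
     'p set \<Rightarrow> ('p \<Rightarrow> 'g) \<Rightarrow> ('p \<Rightarrow> int) \<Rightarrow> complex" where
  "wilson_partition_function G \<rho> \<mu> \<beta> P C \<epsilon> = (\<integral>g. wilson_weight G \<rho> \<beta> P C \<epsilon> g \<partial>\<mu>)"

definition wilson_density ::
    "'g monoid \<Rightarrow> ('g \<Rightarrow> complex^'n^'n) \<Rightarrow> 'g measure \<Rightarrow> real \<Rightarrow>
     'p set \<Rightarrow> ('p \<Rightarrow> 'g) \<Rightarrow> ('p \<Rightarrow> int) \<Rightarrow> 'g \<Rightarrow> complex" where
  "wilson_density G \<rho> \<mu> \<beta> P C \<epsilon> g =
     1 / wilson_partition_function G \<rho> \<mu> \<beta> P C \<epsilon> * wilson_weight G \<rho> \<beta> P C \<epsilon> g"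

end

theory Submission
  imports Defs
begin

text \<open>
  Let \<open>F\<close> be the product of the Wilson loops and \<open>e\<^sup>S\<close> the weight.  A left-invariant vector field
  \<open>\<xi>\<close> generates right translations, under which the Haar measure is invariant, so integrating by
  parts twice gives \<open>\<integral> (\<xi>\<xi>F) e\<^sup>S = \<integral> F (\<xi>\<xi>S + (\<xi>S)\<^sup>2) e\<^sup>S\<close>.  Summed over an orthonormal basis, the
  second derivatives of a loop that fall on one factor \<open>g\<^sup>\<plusminus>\<^sup>1\<close> contribute the Casimir eigenvalue, those
  that fall on two factors of a loop contribute the twisting, and products of first derivatives
  of two loops contribute the merging.  No exponential map is needed: all functions involved
  are polynomials in the entries of \<open>\<rho>(g)\<close> and \<open>\<rho>(g\<^sup>-\<^sup>1)\<close>, on which the abstract derivation \<open>\<xi>\<close> is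
  determined by the Leibniz rule and left invariance, and power series in those.
\<close>

section \<open>Smooth functions\<close>

text \<open>The Frechet derivative at a point of an open set depends only on values near that point,
  so the values outside \<open>S\<close> never matter. This allows derivatives to be replaced by
  explicit formulas valid on \<open>S\<close> alone.\<close>

lemma Ck_on_cong:
  assumes "open S" "\<And>x. x \<in> S \<Longrightarrow> f x = h x" "Ck_on k S f"
  shows "Ck_on k S h"
  using assms(2,3)
proof (induction k arbitrary: f h)
  case 0
  then show ?case by (metis Ck_on.simps(1) continuous_on_cong)
next
  case (Suc k)
  have D: "(h has_derivative frechet_derivative f (at x)) (at x)" if "x \<in> S" for x
  proof (rule has_derivative_transform_within_open[OF _ assms(1) that])
    show "(f has_derivative frechet_derivative f (at x)) (at x)"
      using Suc.prems(2) that frechet_derivative_works by auto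
  qed (rule Suc.prems(1))
  then have "frechet_derivative f (at x) = frechet_derivative h (at x)" if "x \<in> S" for x
    using that frechet_derivative_at by blast
  then have "Ck_on k S (\<lambda>x. frechet_derivative h (at x) v)" for v
    using Suc.IH[of "\<lambda>x. frechet_derivative f (at x) v"] Suc.prems by simp
  then show ?case using D by (auto simp: differentiable_def)
qed

text \<open>By uniqueness of derivatives, any explicit formula \<open>f'\<close> agrees on
  \<open>S\<close> with the chosen \<open>frechet_derivative\<close>. The closure rules below supply
  \<open>f'\<close> from the usual rules of calculus.\<close>

lemma Ck_on_Suc_I:
  assumes "open S" "\<And>x. x \<in> S \<Longrightarrow> (f has_derivative f' x) (at x)"
    "\<And>v. Ck_on k S (\<lambda>x. f' x v)"
  shows "Ck_on (Suc k) S f"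
proof -
  have "f' x v = frechet_derivative f (at x) v" if "x \<in> S" for x v
    using assms(2)[OF that] frechet_derivative_at by metis
  then have "Ck_on k S (\<lambda>x. frechet_derivative f (at x) v)" for v
    using Ck_on_cong[OF assms(1) _ assms(3)[of v]] by simp
  then show ?thesis using assms(2) by (auto simp: differentiable_def)
qed

lemma Ck_on_Suc_has_derivative:
  assumes "Ck_on (Suc k) S f" "x \<in> S"
  shows "(f has_derivative frechet_derivative f (at x)) (at x)"
  using assms frechet_derivative_works by auto

lemma Ck_on_SucD: "Ck_on (Suc k) S f \<Longrightarrow> Ck_on k S f"
proof (induction k arbitrary: f)
  case 0
  then show ?case
    by (auto intro!: continuous_at_imp_continuous_on differentiable_imp_continuous_within)
qed auto

lemma Ck_on_const: "open S \<Longrightarrow> Ck_on k S (\<lambda>x. c)"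
  by (induction k arbitrary: c) (auto intro: continuous_on_const)

lemma Ck_on_add:
  assumes "open S" shows "Ck_on k S f \<Longrightarrow> Ck_on k S h \<Longrightarrow> Ck_on k S (\<lambda>x. f x + h x)"
proof (induction k arbitrary: f h)
  case (Suc k)
  show ?case
    by (rule Ck_on_Suc_I[OF assms has_derivative_add[OF Ck_on_Suc_has_derivative[OF Suc.prems(1)]
          Ck_on_Suc_has_derivative[OF Suc.prems(2)]]])
      (use Suc in auto)
qed (auto intro: continuous_on_add)

lemma Ck_on_bounded_linear:
  assumes "open S" "bounded_linear T" shows "Ck_on k S f \<Longrightarrow> Ck_on k S (\<lambda>x. T (f x))"
proof (induction k arbitrary: f)
  case (Suc k)
  show ?case
    by (rule Ck_on_Suc_I[OF assms(1) bounded_linear.has_derivative[OF assms(2)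
          Ck_on_Suc_has_derivative[OF Suc.prems]]])
      (use Suc in auto)
qed (auto intro: bounded_linear.continuous_on[OF assms(2)])

lemma Ck_on_mult:
  fixes f h :: "'a::real_normed_vector \<Rightarrow> 'b::real_normed_algebra"
  assumes "open S" shows "Ck_on k S f \<Longrightarrow> Ck_on k S h \<Longrightarrow> Ck_on k S (\<lambda>x. f x * h x)"
proof (induction k arbitrary: f h)
  case (Suc k)
  have "Ck_on k S f" "Ck_on k S h" using Suc.prems Ck_on_SucD by auto
  then show ?case
    by (intro Ck_on_Suc_I[OF assms has_derivative_mult[OF Ck_on_Suc_has_derivative[OF Suc.prems(1)]
          Ck_on_Suc_has_derivative[OF Suc.prems(2)]]] Ck_on_add[OF assms] Suc.IH)
      (use Suc.prems in auto)
qed (auto intro: continuous_on_mult)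

text \<open>The derivative of 1/f contains 1/f itself, but only its C^k regularity is required in
  the step to order k + 1, and that is the induction hypothesis.\<close>

lemma Ck_on_inverse:
  fixes f :: "'a::real_normed_vector \<Rightarrow> 'b::real_normed_field"
  assumes "open S" "\<And>x. x \<in> S \<Longrightarrow> f x \<noteq> 0"
  shows "Ck_on k S f \<Longrightarrow> Ck_on k S (\<lambda>x. inverse (f x))"
proof (induction k)
  case (Suc k)
  then have "Ck_on k S (\<lambda>x. inverse (f x))" using Ck_on_SucD by auto
  then have "Ck_on k S (\<lambda>x. - 1 * (inverse (f x) * frechet_derivative f (at x) v * inverse (f x)))" for v
    using Suc.prems by (intro Ck_on_mult Ck_on_const assms) auto
  then show ?case
    by (intro Ck_on_Suc_I[OF assms(1) Deriv.has_derivative_inverse[OF assms(2)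
          Ck_on_Suc_has_derivative[OF Suc.prems]]]) auto
qed (auto intro: continuous_on_inverse simp: assms(2))

section \<open>Smooth functions on a manifold with values in a normed space\<close>

lemma smooth_map_vector_space_iff:
  "smooth_map A vector_space_atlas f \<longleftrightarrow>
     continuous_on UNIV f \<and> (\<forall>(U, \<phi>)\<in>A. \<forall>k. Ck_on k (\<phi> ` U) (\<lambda>x. f (inv_into U \<phi> x)))"
  by (simp add: smooth_map_def vector_space_atlas_def smooth_on_def comp_def)

lemma smooth_atlas_open: "smooth_atlas A \<Longrightarrow> (U, \<phi>) \<in> A \<Longrightarrow> open (\<phi> ` U)"
  unfolding smooth_atlas_def by blast

lemma smooth_map_const:
  "smooth_atlas A \<Longrightarrow> smooth_map A vector_space_atlas (\<lambda>x. c)"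
  by (auto simp: smooth_map_vector_space_iff intro!: Ck_on_const smooth_atlas_open)

lemma smooth_map_add:
  "smooth_atlas A \<Longrightarrow> smooth_map A vector_space_atlas f \<Longrightarrow> smooth_map A vector_space_atlas h \<Longrightarrow>
   smooth_map A vector_space_atlas (\<lambda>x. f x + h x)"
  unfolding smooth_map_vector_space_iff
  by (fastforce intro!: Ck_on_add continuous_on_add intro: smooth_atlas_open)

lemma smooth_map_mult:
  fixes f h :: "'m::{t2_space,second_countable_topology} \<Rightarrow> 'b::real_normed_algebra"
  shows "smooth_atlas A \<Longrightarrow> smooth_map A vector_space_atlas f \<Longrightarrow> smooth_map A vector_space_atlas h \<Longrightarrow>
   smooth_map A vector_space_atlas (\<lambda>x. f x * h x)"
  unfolding smooth_map_vector_space_iff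
  by (fastforce intro!: Ck_on_mult continuous_on_mult intro: smooth_atlas_open)

lemma smooth_map_bounded_linear:
  "smooth_atlas A \<Longrightarrow> bounded_linear T \<Longrightarrow> smooth_map A vector_space_atlas f \<Longrightarrow>
   smooth_map A vector_space_atlas (\<lambda>x. T (f x))"
  unfolding smooth_map_vector_space_iff
  by (fastforce intro!: Ck_on_bounded_linear[where T = T] bounded_linear.continuous_on[of T] intro: smooth_atlas_open)

lemma smooth_map_inverse:
  fixes f :: "'m::{t2_space,second_countable_topology} \<Rightarrow> 'b::real_normed_field"
  shows "smooth_atlas A \<Longrightarrow> (\<And>x. f x \<noteq> 0) \<Longrightarrow> smooth_map A vector_space_atlas f \<Longrightarrow>
   smooth_map A vector_space_atlas (\<lambda>x. inverse (f x))"
  unfolding smooth_map_vector_space_iff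
  by (fastforce intro!: Ck_on_inverse continuous_on_inverse intro: smooth_atlas_open)

lemma smooth_map_sum:
  fixes f :: "'i \<Rightarrow> 'm::{t2_space,second_countable_topology} \<Rightarrow> 'b::real_normed_vector"
  assumes "smooth_atlas A" "\<And>i. i \<in> S \<Longrightarrow> smooth_map A vector_space_atlas (f i)"
  shows "smooth_map A vector_space_atlas (\<lambda>x. \<Sum>i\<in>S. f i x)"
  using assms(2) by (induction S rule: infinite_finite_induct)
    (auto intro!: smooth_map_const smooth_map_add assms(1))

lemma smooth_map_prod:
  fixes f :: "'i \<Rightarrow> 'm::{t2_space,second_countable_topology} \<Rightarrow> 'b::real_normed_field"
  assumes "smooth_atlas A" "\<And>i. i \<in> S \<Longrightarrow> smooth_map A vector_space_atlas (f i)"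
  shows "smooth_map A vector_space_atlas (\<lambda>x. \<Prod>i\<in>S. f i x)"
  using assms(2) by (induction S rule: infinite_finite_induct)
    (auto intro!: smooth_map_const smooth_map_mult assms(1))

section \<open>Haar measure and integration by parts\<close>

locale haar_lie_group =
  fixes G :: "('g::{t2_space,second_countable_topology}) monoid"
    and A :: "('g, 'e::real_normed_vector) atlas"
    and \<mu> :: "'g measure"
  assumes lie: "compact_lie_group G A"
    and haar: "normalized_haar_measure G \<mu>"

sublocale haar_lie_group \<subseteq> group G
  using lie unfolding compact_lie_group_def by blast

sublocale haar_lie_group \<subseteq> prob_space \<mu>
  using haar unfolding normalized_haar_measure_def by blast

context haar_lie_group
begin

lemma carrier_UNIV [simp]: "carrier G = UNIV"
  using lie unfolding compact_lie_group_def by blast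

lemma in_carrier [simp]: "x \<in> carrier G"
  by simp

lemma atlas: "smooth_atlas A"
  using lie unfolding compact_lie_group_def by blast

lemma sets_haar [measurable_cong]: "sets \<mu> = sets borel"
  using haar unfolding normalized_haar_measure_def by blast

lemma space_haar [simp]: "space \<mu> = UNIV"
  using sets_eq_imp_space_eq[OF sets_haar] by simp

section \<open>Continuity of the group operations and integrability on a compact group\<close>

lemma continuous_mult_inv:
  "continuous_on UNIV (\<lambda>(x, y). x \<otimes>\<^bsub>G\<^esub> y)" "continuous_on UNIV (\<lambda>x. inv\<^bsub>G\<^esub> x)"
  using lie unfolding compact_lie_group_def smooth_map_def by blast+

lemma continuous_mult [continuous_intros]:
  "continuous_on S f \<Longrightarrow> continuous_on S h \<Longrightarrow> continuous_on S (\<lambda>x. f x \<otimes>\<^bsub>G\<^esub> h x)"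
  using continuous_on_compose2[OF continuous_mult_inv(1) continuous_on_Pair[of S f h]] by simp

lemma continuous_inv [continuous_intros]:
  "continuous_on S f \<Longrightarrow> continuous_on S (\<lambda>x. inv\<^bsub>G\<^esub> (f x))"
  using continuous_on_compose2[OF continuous_mult_inv(2)] by auto

lemma continuous_bounded:
  fixes f :: "'g \<Rightarrow> 'b::real_normed_vector"
  assumes "continuous_on UNIV f"
  obtains K where "\<And>x. norm (f x) \<le> K"
proof -
  have "compact (UNIV :: 'g set)"
    using lie unfolding compact_lie_group_def by blast
  then have "bounded (range f)"
    using assms compact_continuous_image compact_imp_bounded by blast
  then show thesis using that by (auto simp: bounded_iff)
qed

lemma integrable_continuous:
  fixes f :: "'g \<Rightarrow> complex"
  assumes "continuous_on UNIV f" shows "integrable \<mu> f"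
proof -
  obtain K where "\<And>x. norm (f x) \<le> K" using continuous_bounded[OF assms] by blast
  moreover have "f \<in> borel_measurable \<mu>"
    using borel_measurable_continuous_onI[OF assms] by measurable
  ultimately show ?thesis by (intro integrable_const_bound[of _ K]) auto
qed

section \<open>Invariance of the Haar integral under translations and inversion\<close>

lemma integral_left_translate:
  fixes f :: "'g \<Rightarrow> complex"
  assumes "continuous_on UNIV f"
  shows "(\<integral>x. f (h \<otimes>\<^bsub>G\<^esub> x) \<partial>\<mu>) = (\<integral>x. f x \<partial>\<mu>)"
proof -
  have m: "(\<lambda>x. h \<otimes>\<^bsub>G\<^esub> x) \<in> measurable \<mu> borel"
    using borel_measurable_continuous_onI[OF continuous_mult[OF continuous_on_const continuous_on_id]]
    by (simp add: measurable_cong_sets[OF sets_haar])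
  have "distr \<mu> borel (\<lambda>x. h \<otimes>\<^bsub>G\<^esub> x) = \<mu>"
  proof (rule measure_eqI)
    fix S assume "S \<in> sets (distr \<mu> borel (\<lambda>x. h \<otimes>\<^bsub>G\<^esub> x))"
    then have S: "S \<in> sets borel" by simp
    \<comment> \<open>Invariance is given for images of Borel sets, whereas the push-forward measure
      involves preimages; a preimage under translation by \<open>h\<close> is an image under
      translation by its inverse.\<close>
    have "(\<lambda>x. h \<otimes>\<^bsub>G\<^esub> x) -` S = (\<lambda>x. inv\<^bsub>G\<^esub> h \<otimes>\<^bsub>G\<^esub> x) ` S"
    proof (rule equalityI; rule subsetI)
      fix x assume "x \<in> (\<lambda>x. h \<otimes>\<^bsub>G\<^esub> x) -` S"
      then show "x \<in> (\<lambda>x. inv\<^bsub>G\<^esub> h \<otimes>\<^bsub>G\<^esub> x) ` S"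
        by (intro image_eqI[of _ _ "h \<otimes>\<^bsub>G\<^esub> x"]) (auto simp: m_assoc[symmetric])
    qed (auto simp: m_assoc[symmetric])
    then show "emeasure (distr \<mu> borel (\<lambda>x. h \<otimes>\<^bsub>G\<^esub> x)) S = emeasure \<mu> S"
      using haar S by (simp add: emeasure_distr[OF m] normalized_haar_measure_def)
  qed (simp add: sets_haar)
  then show ?thesis
    using integral_distr[OF m, of f] borel_measurable_continuous_onI[OF assms] by simp
qed

text \<open>
  Integrating \<open>f (x\<^sup>-\<^sup>1 y)\<close> over \<open>x\<close> and \<open>y\<close> in either order shows that \<open>\<mu>\<close> is invariant
  under inversion, hence also under right translations.
\<close>

lemma integral_inv:
  fixes f :: "'g \<Rightarrow> complex"
  assumes f: "continuous_on UNIV f"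
  shows "(\<integral>x. f (inv\<^bsub>G\<^esub> x) \<partial>\<mu>) = (\<integral>x. f x \<partial>\<mu>)"
proof -
  \<comment> \<open>Total mass 1, so that averaging a constant returns it.\<close>
  have 1: "measure \<mu> UNIV = 1" using prob_space by simp
  interpret pair_prob_space \<mu> \<mu> ..
  let ?F = "\<lambda>x y. f (inv\<^bsub>G\<^esub> x \<otimes>\<^bsub>G\<^esub> y)"
  have "continuous_on UNIV (\<lambda>z. ?F (fst z) (snd z))"
    by (intro continuous_on_compose2[OF f] continuous_intros) auto
  then have "(\<lambda>z. ?F (fst z) (snd z)) \<in> borel_measurable (borel \<Otimes>\<^sub>M borel)"
    \<comment> \<open>Second countability enters here: the product of the Borel sigma-algebras is
      the Borel sigma-algebra of the product, so joint continuity gives joint measurability.\<close>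
    unfolding borel_prod by (rule borel_measurable_continuous_onI)
  then have m: "(\<lambda>z. ?F (fst z) (snd z)) \<in> borel_measurable (\<mu> \<Otimes>\<^sub>M \<mu>)"
    using measurable_cong_sets[OF sets_pair_measure_cong[OF sets_haar sets_haar]] by blast
  obtain K where "\<And>x. norm (f x) \<le> K" using continuous_bounded[OF f] by blast
  then have "integrable (\<mu> \<Otimes>\<^sub>M \<mu>) (\<lambda>(x, y). ?F x y)"
    using m by (intro P.integrable_const_bound[of _ K]) (auto simp: case_prod_beta')
  then have "(\<integral>y. (\<integral>x. ?F x y \<partial>\<mu>) \<partial>\<mu>) = (\<integral>x. (\<integral>y. ?F x y \<partial>\<mu>) \<partial>\<mu>)"
    by (rule Fubini_integral)
  moreover have "(\<integral>y. ?F x y \<partial>\<mu>) = (\<integral>x. f x \<partial>\<mu>)" for x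
    by (rule integral_left_translate[OF f])
  moreover have "(\<integral>x. ?F x y \<partial>\<mu>) = (\<integral>x. f (inv\<^bsub>G\<^esub> x) \<partial>\<mu>)" for y
  proof -
    have "continuous_on UNIV (\<lambda>x. ?F x y)"
      by (intro continuous_on_compose2[OF f] continuous_intros) auto
    \<comment> \<open>Replacing x by y x cancels y, because (y x)^-1 y = x^-1.\<close>
    from integral_left_translate[OF this, of y] show ?thesis
      by (simp add: inv_mult_group m_assoc)
  qed
  ultimately show ?thesis by (simp add: 1)
qed

lemma integral_right_translate:
  fixes f :: "'g \<Rightarrow> complex"
  assumes f: "continuous_on UNIV f"
  shows "(\<integral>x. f (x \<otimes>\<^bsub>G\<^esub> y) \<partial>\<mu>) = (\<integral>x. f x \<partial>\<mu>)"
proof -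
  have c: "continuous_on UNIV (\<lambda>x. f (inv\<^bsub>G\<^esub> x))" "continuous_on UNIV (\<lambda>x. f (x \<otimes>\<^bsub>G\<^esub> y))"
    by (intro continuous_on_compose2[OF f] continuous_intros; simp)+
  \<comment> \<open>Inversion turns the right translation by \<open>y\<close> into the left
    translation by its inverse.\<close>
  have "(\<integral>x. f (x \<otimes>\<^bsub>G\<^esub> y) \<partial>\<mu>) = (\<integral>x. f (inv\<^bsub>G\<^esub> (inv\<^bsub>G\<^esub> y \<otimes>\<^bsub>G\<^esub> x)) \<partial>\<mu>)"
    using integral_inv[OF c(2)] by (simp add: inv_mult_group)
  then show ?thesis
    by (simp add: integral_left_translate[OF c(1)] integral_inv[OF f])
qed

section \<open>Functions for which averaging commutes with derivations\<close>

abbreviation smooth_c :: "('g \<Rightarrow> complex) \<Rightarrow> bool" where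
  "smooth_c \<equiv> smooth_map A vector_space_atlas"

lemma smooth_c_continuous: "smooth_c f \<Longrightarrow> continuous_on UNIV f"
  by (simp add: smooth_map_def)

lemma smooth_c_Re_Im:
  assumes "smooth_c f"
  shows "(\<lambda>x. Re (f x)) \<in> smooth_functions A" "(\<lambda>x. Im (f x)) \<in> smooth_functions A"
  unfolding smooth_functions_def
  using smooth_map_bounded_linear[OF atlas bounded_linear_Re assms]
    smooth_map_bounded_linear[OF atlas bounded_linear_Im assms] by simp_all

text \<open>The algebraic tensor product of continuous and smooth functions, realized as functions
  of two variables: the first variable will be integrated, the second differentiated.\<close>

inductive separable :: "('g \<Rightarrow> 'g \<Rightarrow> complex) \<Rightarrow> bool" where
  product: "continuous_on UNIV a \<Longrightarrow> smooth_c b \<Longrightarrow> separable (\<lambda>x y. a x * b y)"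
| add: "separable F \<Longrightarrow> separable H \<Longrightarrow> separable (\<lambda>x y. F x y + H x y)"

lemma separable_continuous: "separable F \<Longrightarrow> continuous_on UNIV (\<lambda>x. F x y)"
  by (induction rule: separable.induct) (auto intro!: continuous_intros)

lemma separable_smooth: "separable F \<Longrightarrow> smooth_c (F x)"
  by (induction rule: separable.induct)
    (auto intro!: smooth_map_add smooth_map_mult smooth_map_const atlas)

lemma separable_mult:
  assumes "separable F" "separable H"
  shows "separable (\<lambda>x y. F x y * H x y)"
  using assms
proof (induction rule: separable.induct)
  case (product a b)
  from product(3) show ?case
  proof (induction rule: separable.induct)
    case (product a' b')
    have "separable (\<lambda>x y. (a x * a' x) * (b y * b' y))"
      using product \<open>continuous_on UNIV a\<close> \<open>smooth_c b\<close>
      by (intro separable.product continuous_intros smooth_map_mult atlas)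
    then show ?case by (simp add: mult_ac)
  next
    case (add F H)
    then show ?case using separable.add[OF add.IH] by (simp add: distrib_left)
  qed
next
  case (add F1 F2)
  then show ?case using separable.add[OF add.IH(1) add.IH(2)] by (simp add: distrib_right)
qed

text \<open>
  For the functions \<open>f\<close> below, every derivation commutes with the averaging \<open>\<integral> f (x y) dx\<close>
  for purely algebraic reasons.
\<close>

definition representative :: "('g \<Rightarrow> complex) \<Rightarrow> bool" where
  "representative f \<longleftrightarrow> smooth_c f \<and> separable (\<lambda>x y. f (x \<otimes>\<^bsub>G\<^esub> y))"

text \<open>The complexification of \<open>X\<close>, which as an element of the Lie algebra acts on
  real functions only.\<close>

definition vf_apply :: "'g vector_field \<Rightarrow> ('g \<Rightarrow> complex) \<Rightarrow> 'g \<Rightarrow> complex" where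
  "vf_apply X f g = Complex (X (\<lambda>x. Re (f x)) g) (X (\<lambda>x. Im (f x)) g)"

text \<open>Representativity is bundled with the derivative, so that the sum and product rules
  propagate both at once. It is demanded of \<open>f\<close> only; a second derivative calls for a
  separate \<open>has_vf\<close> statement about \<open>f'\<close>.\<close>

definition has_vf :: "'g vector_field \<Rightarrow> ('g \<Rightarrow> complex) \<Rightarrow> ('g \<Rightarrow> complex) \<Rightarrow> bool" where
  "has_vf X f f' \<longleftrightarrow> representative f \<and> (\<forall>g. vf_apply X f g = f' g)"

end

section \<open>Action of a left-invariant field on complex functions\<close>

locale lie_group_field = haar_lie_group G A \<mu>
  for G :: "('g::{t2_space,second_countable_topology}) monoid"
    and A :: "('g, 'e::real_normed_vector) atlas"
    and \<mu> :: "'g measure" +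
  fixes X :: "'g vector_field"
  assumes X: "X \<in> lie_algebra G A"
begin

abbreviation D :: "('g \<Rightarrow> complex) \<Rightarrow> 'g \<Rightarrow> complex" where
  "D \<equiv> vf_apply X"

lemma X_add: "f \<in> smooth_functions A \<Longrightarrow> h \<in> smooth_functions A \<Longrightarrow>
    X (\<lambda>x. f x + h x) = (\<lambda>x. X f x + X h x)"
  and X_cmult: "f \<in> smooth_functions A \<Longrightarrow> X (\<lambda>x. c * f x) = (\<lambda>x. c * X f x)"
  and X_mult: "f \<in> smooth_functions A \<Longrightarrow> h \<in> smooth_functions A \<Longrightarrow>
    X (\<lambda>x. f x * h x) = (\<lambda>x. X f x * h x + f x * X h x)"
  and X_left: "f \<in> smooth_functions A \<Longrightarrow> X (\<lambda>x. f (a \<otimes>\<^bsub>G\<^esub> x)) = (\<lambda>x. X f (a \<otimes>\<^bsub>G\<^esub> x))"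
  using X unfolding lie_algebra_def by blast+

text \<open>The real part of a complex product is a difference of real products, so the complex
  Leibniz rule \<open>D_mult\<close> rests on this.\<close>

lemma X_diff:
  assumes "f \<in> smooth_functions A" "h \<in> smooth_functions A"
  shows "X (\<lambda>x. f x - h x) = (\<lambda>x. X f x - X h x)"
proof -
  have "(\<lambda>x. -1 * h x) \<in> smooth_functions A"
    using smooth_map_mult[OF atlas smooth_map_const[OF atlas, of "-1"]] assms(2)
    unfolding smooth_functions_def by blast
  then show ?thesis
    using X_add[OF assms(1)] X_cmult[OF assms(2), of "-1"] by fastforce
qed

lemma smooth_functions_mult:
  "f \<in> smooth_functions A \<Longrightarrow> h \<in> smooth_functions A \<Longrightarrow> (\<lambda>x. f x * h x) \<in> smooth_functions A"
  unfolding smooth_functions_def by (auto intro: smooth_map_mult[OF atlas])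

lemma D_add: "smooth_c f \<Longrightarrow> smooth_c h \<Longrightarrow> D (\<lambda>x. f x + h x) g = D f g + D h g"
  by (simp add: vf_apply_def complex_eq_iff X_add smooth_c_Re_Im)

lemma D_mult: "smooth_c f \<Longrightarrow> smooth_c h \<Longrightarrow> D (\<lambda>x. f x * h x) g = D f g * h g + f g * D h g"
  by (simp add: vf_apply_def complex_eq_iff X_add X_diff X_mult smooth_c_Re_Im
      smooth_functions_mult algebra_simps)

text \<open>Applying the Leibniz rule to 1 = 1 * 1 gives D 1 = 2 D 1, hence D 1 = 0; the other
  constants follow by scaling.\<close>

lemma D_const: "D (\<lambda>x. c) g = 0"
proof -
  have 1: "D (\<lambda>x. 1) g = 0"
    using D_mult[OF smooth_map_const[OF atlas] smooth_map_const[OF atlas], of 1 1 g] by simp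
  have "X (\<lambda>x. 1) g = 0" using 1 by (simp add: vf_apply_def complex_eq_iff)
  moreover have "(\<lambda>x. 1) \<in> smooth_functions A"
    unfolding smooth_functions_def using smooth_map_const[OF atlas] by simp
  ultimately have "X (\<lambda>x. c) g = 0" for c
    using X_cmult[of "\<lambda>x. 1" c] by simp
  then show ?thesis by (simp add: vf_apply_def complex_eq_iff)
qed

lemma D_left: "smooth_c f \<Longrightarrow> D (\<lambda>x. f (a \<otimes>\<^bsub>G\<^esub> x)) g = D f (a \<otimes>\<^bsub>G\<^esub> g)"
  using X_left[OF smooth_c_Re_Im(1), of f a] X_left[OF smooth_c_Re_Im(2), of f a]
  by (simp add: vf_apply_def)

text \<open>For a single product a(x) b(y) the integral is the constant
  \<open>\<integral>x. a x\<close> times b, so only linearity of \<open>D\<close> is involved and no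
  limit is interchanged. The three claims are proved together because the sum case uses continuity
  for integrability and smoothness for additivity of \<open>D\<close>.\<close>

lemma separable_D:
  "separable F \<Longrightarrow> continuous_on UNIV (\<lambda>x. D (F x) y) \<and>
     smooth_c (\<lambda>y. \<integral>x. F x y \<partial>\<mu>) \<and> D (\<lambda>y. \<integral>x. F x y \<partial>\<mu>) y = (\<integral>x. D (F x) y \<partial>\<mu>)"
proof (induction rule: separable.induct)
  case (product a b)
  have "D (\<lambda>y. a x * b y) y = a x * D b y" for x
    using D_mult[OF smooth_map_const[OF atlas] product(2), of "a x" y] by (simp add: D_const)
  moreover have "D (\<lambda>y. (\<integral>x. a x \<partial>\<mu>) * b y) y = (\<integral>x. a x \<partial>\<mu>) * D b y"
    using D_mult[OF smooth_map_const[OF atlas] product(2), of "\<integral>x. a x \<partial>\<mu>" y] by (simp add: D_const)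
  ultimately show ?case
    using product by (auto intro!: continuous_intros smooth_map_mult smooth_map_const atlas)
next
  case (add F H)
  have "D (\<lambda>y. F x y + H x y) y = D (F x) y + D (H x) y" for x
    by (intro D_add separable_smooth add.hyps)
  then show ?case
    using add by (auto simp: integrable_continuous separable_continuous D_add
        intro!: continuous_intros smooth_map_add atlas)
qed

text \<open>By left invariance, D f at x is the derivative at the identity of y |-> f(x y).
  Separability makes this continuous in x.\<close>

lemma has_vf_continuous:
  assumes "has_vf X f f'" shows "continuous_on UNIV f'"
proof -
  have "separable (\<lambda>x y. f (x \<otimes>\<^bsub>G\<^esub> y))" "smooth_c f" "\<And>g. D f g = f' g"
    using assms by (auto simp: has_vf_def representative_def)
  then show ?thesis
    using separable_D[of "\<lambda>x y. f (x \<otimes>\<^bsub>G\<^esub> y)" "\<one>\<^bsub>G\<^esub>"] by (simp add: D_left)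
qed

lemma has_vf_continuous_base: "has_vf X f f' \<Longrightarrow> continuous_on UNIV f"
  by (simp add: has_vf_def representative_def smooth_c_continuous)

text \<open>The average of f(x y) over x does not depend on y, by right invariance, so its
  derivative in y vanishes. By \<open>separable_D\<close> and left invariance, that derivative at
  the identity is the integral of D f.\<close>

lemma has_vf_integral_eq_0:
  assumes "has_vf X f f'" shows "(\<integral>g. f' g \<partial>\<mu>) = 0"
proof -
  have f: "separable (\<lambda>x y. f (x \<otimes>\<^bsub>G\<^esub> y))" "smooth_c f" "\<And>g. D f g = f' g"
    using assms by (auto simp: has_vf_def representative_def)
  have "(\<integral>g. f' g \<partial>\<mu>) = D (\<lambda>y. \<integral>x. f (x \<otimes>\<^bsub>G\<^esub> y) \<partial>\<mu>) \<one>\<^bsub>G\<^esub>"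
    using separable_D[OF f(1), of "\<one>\<^bsub>G\<^esub>"] f(2,3) by (simp add: D_left)
  then show ?thesis
    by (simp add: integral_right_translate[OF smooth_c_continuous[OF f(2)]] D_const)
qed

section \<open>Rules of differentiation for representative functions\<close>

lemma has_vf_const: "has_vf X (\<lambda>x. c) (\<lambda>x. 0)"
  using separable.product[OF continuous_on_const[of _ c] smooth_map_const[OF atlas, of 1]]
  by (simp add: has_vf_def representative_def D_const smooth_map_const[OF atlas])

lemma has_vf_add:
  "has_vf X f f' \<Longrightarrow> has_vf X h h' \<Longrightarrow> has_vf X (\<lambda>x. f x + h x) (\<lambda>x. f' x + h' x)"
  by (auto simp: has_vf_def representative_def D_add smooth_map_add[OF atlas] intro!: separable.add)

lemma has_vf_mult:
  "has_vf X f f' \<Longrightarrow> has_vf X h h' \<Longrightarrow> has_vf X (\<lambda>x. f x * h x) (\<lambda>x. f' x * h x + f x * h' x)"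
  by (auto simp: has_vf_def representative_def D_mult smooth_map_mult[OF atlas] intro!: separable_mult)

lemma has_vf_cmult: "has_vf X f f' \<Longrightarrow> has_vf X (\<lambda>x. c * f x) (\<lambda>x. c * f' x)"
  using has_vf_mult[OF has_vf_const[of c], of f f'] by simp

lemma has_vf_sum:
  assumes "\<And>i. i \<in> S \<Longrightarrow> has_vf X (f i) (f' i)"
  shows "has_vf X (\<lambda>x. \<Sum>i\<in>S. f i x) (\<lambda>x. \<Sum>i\<in>S. f' i x)"
  using assms by (induction S rule: infinite_finite_induct) (auto intro: has_vf_const has_vf_add)

lemma has_vf_prod:
  assumes "finite S" "\<And>i. i \<in> S \<Longrightarrow> has_vf X (f i) (f' i)"
  shows "has_vf X (\<lambda>x. \<Prod>i\<in>S. f i x) (\<lambda>x. \<Sum>i\<in>S. f' i x * (\<Prod>k\<in>S - {i}. f k x))"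
  using assms
proof (induction S rule: finite_induct)
  case (insert a S)
  have "(\<Sum>i\<in>S. f' i x * (\<Prod>k\<in>insert a S - {i}. f k x)) =
      f a x * (\<Sum>i\<in>S. f' i x * (\<Prod>k\<in>S - {i}. f k x))" for x
    unfolding sum_distrib_left
  proof (rule sum.cong)
    fix i assume i: "i \<in> S"
    then have "insert a S - {i} = insert a (S - {i})" using insert.hyps by auto
    then show "f' i x * (\<Prod>k\<in>insert a S - {i}. f k x) = f a x * (f' i x * (\<Prod>k\<in>S - {i}. f k x))"
      using insert.hyps by simp
  qed simp
  then show ?case
    using has_vf_mult[OF insert.prems[of a] insert.IH] insert by simp
qed (auto intro: has_vf_const)

section \<open>Integration by parts against an exponential weight\<close>

text \<open>
  The exponential is not known to be representative, so it is replaced by its partial sums.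
\<close>

lemma integral_exp_by_parts:
  assumes f: "has_vf X f f'" and S: "has_vf X S S'"
  shows "(\<integral>g. (f' g + f g * S' g) * exp (S g) \<partial>\<mu>) = 0"
proof -
  define E where "E n g = (\<Sum>k<n. S g ^ k /\<^sub>R fact k)" for n g
  \<comment> \<open>For n = 0 the truncated exponent n - 1 is harmless, since the factor
    \<open>of_nat n\<close> vanishes.\<close>
  have pow: "has_vf X (\<lambda>g. S g ^ n) (\<lambda>g. of_nat n * S g ^ (n - 1) * S' g)" for n
  proof (induction n)
    case (Suc n)
    then show ?case using has_vf_mult[OF S Suc]
      by (cases n) (simp_all add: algebra_simps)
  qed (simp add: has_vf_const)
  \<comment> \<open>As for the exponential series, differentiation lowers the degree by one: S^k /
    k! becomes S' S^(k-1) / (k-1)!, which shifts the partial sum from \<open>Suc n\<close> terms to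
    \<open>n\<close>.\<close>
  have E: "has_vf X (E (Suc n)) (\<lambda>g. S' g * E n g)" for n
  proof (induction n)
    case 0
    then show ?case using has_vf_const[of 1] by (simp add: E_def[abs_def])
  next
    case (Suc n)
    have eq: "E (Suc (Suc n)) = (\<lambda>g. E (Suc n) g + complex_of_real (inverse (fact (Suc n))) * S g ^ Suc n)"
      by (simp add: E_def fun_eq_iff scaleR_conv_of_real)
    have "complex_of_real (inverse (fact (Suc n))) * (of_nat (Suc n) * S g ^ n * S' g) =
       S' g * (S g ^ n /\<^sub>R fact n)" for g
      by (simp add: scaleR_conv_of_real field_simps del: of_nat_Suc)
    then have "S' g * E (Suc n) g = S' g * E n g +
        complex_of_real (inverse (fact (Suc n))) * (of_nat (Suc n) * S g ^ (Suc n - 1) * S' g)" for g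
      by (simp add: E_def distrib_left)
    then show ?case
      unfolding eq using has_vf_add[OF Suc has_vf_cmult[OF pow[of "Suc n"]]] by presburger
  qed
  define I where "I n g = f' g * E (Suc n) g + f g * (S' g * E n g)" for n g
  have I: "has_vf X (\<lambda>g. f g * E (Suc n) g) (I n)" for n
    unfolding I_def by (rule has_vf_mult[OF f E])
  \<comment> \<open>A majorant of all \<open>I n\<close>, obtained by bounding every partial sum by
    the exponential of the norm. It is continuous, hence integrable on the compact group.\<close>
  define w where "w g = (norm (f' g) + norm (f g * S' g)) * exp (norm (S g))" for g
  have c: "continuous_on UNIV f" "continuous_on UNIV f'" "continuous_on UNIV S" "continuous_on UNIV S'"
    using f S has_vf_continuous has_vf_continuous_base by blast+
  have E_le: "norm (E n g) \<le> exp (norm (S g))" for n g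
  proof -
    have "norm (E n g) \<le> (\<Sum>k<n. norm (S g) ^ k /\<^sub>R fact k)"
      unfolding E_def by (rule order_trans[OF norm_sum]) (simp add: norm_power)
    also have "\<dots> \<le> exp (norm (S g))"
      unfolding exp_def by (intro sum_le_suminf summable_exp_generic) auto
    finally show ?thesis .
  qed
  have E_lim: "(\<lambda>n. E n g) \<longlonglongrightarrow> exp (S g)" for g
    using exp_converges[of "S g"] by (simp add: E_def sums_def)
  have "(\<lambda>n. \<integral>g. I n g \<partial>\<mu>) \<longlonglongrightarrow> (\<integral>g. (f' g + f g * S' g) * exp (S g) \<partial>\<mu>)"
  proof (rule integral_dominated_convergence[of _ _ _ w])
    have "continuous_on UNIV (\<lambda>g. complex_of_real (w g))"
      unfolding w_def using c by (intro continuous_intros)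
    from integrable_Re[OF integrable_continuous[OF this]] show "integrable \<mu> w" by simp
    have "continuous_on UNIV (\<lambda>g. (f' g + f g * S' g) * exp (S g))"
      using c by (intro continuous_intros)
    from integrable_continuous[OF this]
    show "(\<lambda>g. (f' g + f g * S' g) * exp (S g)) \<in> borel_measurable \<mu>"
      by (rule borel_measurable_integrable)
    show "I n \<in> borel_measurable \<mu>" for n
      using integrable_continuous[OF has_vf_continuous[OF I]] by (rule borel_measurable_integrable)
    show "AE g in \<mu>. (\<lambda>n. I n g) \<longlonglongrightarrow> (f' g + f g * S' g) * exp (S g)"
    proof (rule AE_I2)
      fix g
      have "(\<lambda>n. I n g) \<longlonglongrightarrow> f' g * exp (S g) + f g * (S' g * exp (S g))"
        unfolding I_def by (intro tendsto_intros E_lim LIMSEQ_Suc[OF E_lim])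
      then show "(\<lambda>n. I n g) \<longlonglongrightarrow> (f' g + f g * S' g) * exp (S g)"
        by (simp add: algebra_simps)
    qed
    show "AE g in \<mu>. norm (I n g) \<le> w g" for n
    proof (rule AE_I2)
      fix g
      have "norm (I n g) \<le> norm (f' g) * norm (E (Suc n) g) + norm (f g * S' g) * norm (E n g)"
        unfolding I_def by (rule order_trans[OF norm_triangle_ineq]) (simp add: norm_mult)
      also have "\<dots> \<le> norm (f' g) * exp (norm (S g)) + norm (f g * S' g) * exp (norm (S g))"
        by (intro add_mono mult_left_mono E_le) auto
      finally show "norm (I n g) \<le> w g" by (simp add: w_def algebra_simps)
    qed
  qed
  moreover have "(\<integral>g. I n g \<partial>\<mu>) = 0" for n
    by (rule has_vf_integral_eq_0[OF I])
  ultimately show ?thesis using LIMSEQ_unique[OF _ tendsto_const] by fastforce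
qed

text \<open>Integration by parts is applied to F1 and to the product F S1. Both vanishing integrals
  contain the mixed term F1 S1, which cancels on subtraction.\<close>

lemma second_order_by_parts:
  assumes F: "has_vf X F F1" "has_vf X F1 F2" and S: "has_vf X S S1" "has_vf X S1 S2"
  shows "(\<integral>g. F2 g * exp (S g) \<partial>\<mu>) = (\<integral>g. F g * (S2 g + S1 g * S1 g) * exp (S g) \<partial>\<mu>)"
proof -
  have c: "continuous_on UNIV F" "continuous_on UNIV F1" "continuous_on UNIV F2"
    "continuous_on UNIV S" "continuous_on UNIV S1" "continuous_on UNIV S2"
    using F S has_vf_continuous has_vf_continuous_base by blast+
  have "(\<integral>g. (F2 g + F1 g * S1 g) * exp (S g) \<partial>\<mu>) = 0"
    by (rule integral_exp_by_parts[OF F(2) S(1)])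
  moreover have "(\<integral>g. (F1 g * S1 g + F g * S2 g + F g * S1 g * S1 g) * exp (S g) \<partial>\<mu>) = 0"
    by (rule integral_exp_by_parts[OF has_vf_mult[OF F(1) S(2)] S(1)])
  moreover have "(\<integral>g. (F2 g + F1 g * S1 g) * exp (S g) \<partial>\<mu>) -
      (\<integral>g. (F1 g * S1 g + F g * S2 g + F g * S1 g * S1 g) * exp (S g) \<partial>\<mu>) =
     (\<integral>g. F2 g * exp (S g) \<partial>\<mu>) - (\<integral>g. F g * (S2 g + S1 g * S1 g) * exp (S g) \<partial>\<mu>)"
    using c by (subst (1 2) Bochner_Integration.integral_diff[symmetric])
      (auto intro!: integrable_continuous continuous_intros simp: algebra_simps)
  ultimately show ?thesis by simp
qed

end

section \<open>Wilson loops as traces of matrix products\<close>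

definition mat_prod :: "('a::semiring_1^'n^'n) list \<Rightarrow> 'a^'n^'n" where
  "mat_prod Ms = foldr (**) Ms (mat 1)"

lemma mat_prod_simps [simp]:
  "mat_prod [] = mat 1" "mat_prod (M # Ms) = M ** mat_prod Ms"
  by (simp_all add: mat_prod_def)

lemma mat_prod_append [simp]: "mat_prod (Ms @ Ns) = mat_prod Ms ** mat_prod Ns"
  by (induction Ms) (simp_all add: matrix_mul_assoc)

lemma matrix_mult_sum_right:
  fixes N :: "'a::comm_ring_1^'n^'n"
  shows "N ** (\<Sum>i\<in>S. M i) = (\<Sum>i\<in>S. N ** M i)"
  unfolding vec_eq_iff matrix_matrix_mult_def sum_component vec_lambda_beta sum_distrib_left
  by (intro allI sum.swap)

lemma matrix_mult_sum_left:
  fixes N :: "'a::comm_ring_1^'n^'n"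
  shows "(\<Sum>i\<in>S. M i) ** N = (\<Sum>i\<in>S. M i ** N)"
  unfolding vec_eq_iff matrix_matrix_mult_def sum_component vec_lambda_beta sum_distrib_right
  by (intro allI sum.swap)

lemma trace_sum: "trace (\<Sum>i\<in>S. M i) = (\<Sum>i\<in>S. trace (M i))"
  unfolding trace_def sum_component by (rule sum.swap)

text \<open>Used to pull the scalar Casimir operator out from the middle of a trace.\<close>

lemma trace_mat_mult:
  fixes M N :: "'a::comm_ring_1^'n^'n"
  shows "trace (M ** (mat c ** N)) = c * trace (M ** N)"
proof -
  have "mat c ** N = (\<chi> i j. c * N $ i $ j)"
    by (simp add: matrix_matrix_mult_def mat_def vec_eq_iff if_distrib if_distribR cong: if_cong)
  then show ?thesis
    by (simp add: trace_def matrix_matrix_mult_def sum_distrib_left mult_ac)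
qed

section \<open>Cyclic arcs of positions in a loop\<close>

lemma upt_split: "j < n \<Longrightarrow> [i..<n] = [i..<j] @ j # [Suc j..<n]" if "i \<le> j"
  using that by (metis le_Suc_ex less_imp_le_nat upt_add_eq_append upt_conv_Cons)

lemma rotate_upt: "j < n \<Longrightarrow> rotate (Suc j) [0..<n] = [Suc j..<n] @ [0..<Suc j]"
  using rotate_append[of "[0..<Suc j]" "[Suc j..<n]"] upt_add_eq_append[of 0 "Suc j" "n - Suc j"]
  by simp

text \<open>The positions strictly between \<open>a\<close> and \<open>b\<close> when the arc does
  not wrap around: the modulus reduces the count to b - a - 1.\<close>

lemma arc_less:
  assumes "a < b" "b < n"
  shows "take ((b + n - Suc a) mod n) (rotate (Suc a) [0..<n]) = [Suc a..<b]"
proof -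
  have "(b + n - Suc a) mod n = b - Suc a"
    using assms by (metis Nat.add_diff_assoc2 Suc_leI less_imp_diff_less mod_add_self2 mod_less)
  then show ?thesis
    using assms by (simp add: rotate_upt upt_split[of "Suc a" b n] del: upt_Suc rotate_Suc)
qed

text \<open>The arc that wraps past the end. For a = b it consists of all n - 1 other positions,
  which is the full cycle in \<open>loop_segment\<close>.\<close>

lemma arc_ge:
  assumes "b \<le> a" "a < n"
  shows "take ((b + n - Suc a) mod n) (rotate (Suc a) [0..<n]) = [Suc a..<n] @ [0..<b]"
proof -
  have "(b + n - Suc a) mod n = n - Suc a + b"
    using assms by simp
  then show ?thesis
    using assms by (simp add: rotate_upt upt_split[of 0 b "Suc a"] del: upt_Suc rotate_Suc)
qed

section \<open>Factors of a loop and their derivatives\<close>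

context haar_lie_group
begin

text \<open>Primes denote derivatives along the vector field \<open>Y\<close>.\<close>

definition letter :: "('g \<Rightarrow> complex^'n^'n) \<Rightarrow> 'g loop \<Rightarrow> 'g \<Rightarrow> nat \<Rightarrow> complex^'n^'n" where
  "letter \<rho> l g i = \<rho> (fst (l ! i)) ** \<rho> (g [^]\<^bsub>G\<^esub> snd (l ! i))"

definition letter' ::
    "('g \<Rightarrow> complex^'n^'n) \<Rightarrow> 'g loop \<Rightarrow> 'g vector_field \<Rightarrow> 'g \<Rightarrow> nat \<Rightarrow> complex^'n^'n" where
  "letter' \<rho> l Y g i = \<rho> (fst (l ! i)) ** insertion G \<rho> Y (snd (l ! i)) g"

text \<open>For the sign -1 no minus sign appears: differentiating the inverse twice produces two
  that cancel.\<close>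

definition letter'' ::
    "('g \<Rightarrow> complex^'n^'n) \<Rightarrow> 'g loop \<Rightarrow> 'g vector_field \<Rightarrow> 'g \<Rightarrow> nat \<Rightarrow> complex^'n^'n" where
  "letter'' \<rho> l Y g i = \<rho> (fst (l ! i)) **
     (if snd (l ! i) = 1 then \<rho> g ** (induced_rep G \<rho> Y ** induced_rep G \<rho> Y)
      else (induced_rep G \<rho> Y ** induced_rep G \<rho> Y) ** \<rho> (inv\<^bsub>G\<^esub> g))"

definition wilson' ::
    "('g \<Rightarrow> complex^'n^'n) \<Rightarrow> 'g loop \<Rightarrow> 'g vector_field \<Rightarrow> 'g \<Rightarrow> complex" where
  "wilson' \<rho> l Y g =
     (\<Sum>j<length l. trace (loop_segment G \<rho> l j j g ** insertion G \<rho> Y (snd (l ! j)) g))"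

text \<open>The first trace arises when both derivatives hit the same factor. The others arise when
  they hit two distinct factors and are the summands of \<open>twisting_at\<close> for one basis
  element.\<close>

definition wilson'' ::
    "('g \<Rightarrow> complex^'n^'n) \<Rightarrow> 'g loop \<Rightarrow> 'g vector_field \<Rightarrow> 'g \<Rightarrow> complex" where
  "wilson'' \<rho> l Y g = (\<Sum>j<length l.
     trace (mat_prod (map (\<lambda>i. if i = j then letter'' \<rho> l Y g i else letter \<rho> l g i) [0..<length l])) +
     (\<Sum>j'\<in>{..<length l} - {j}.
        trace (loop_segment G \<rho> l j' j g ** insertion G \<rho> Y (snd (l ! j)) g **
               loop_segment G \<rho> l j j' g ** insertion G \<rho> Y (snd (l ! j')) g)))"

section \<open>Matrix entries of a representation as representative functions\<close>

context
  fixes \<rho> :: "'g \<Rightarrow> complex^'n^'n"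
  assumes rep: "lie_group_representation G A \<rho>"
begin

lemma rep_one: "\<rho> \<one>\<^bsub>G\<^esub> = mat 1"
  and rep_mult: "\<rho> (x \<otimes>\<^bsub>G\<^esub> y) = \<rho> x ** \<rho> y"
  and rep_smooth: "smooth_map A vector_space_atlas \<rho>"
  using rep unfolding lie_group_representation_def by blast+

lemma rep_inv_right: "\<rho> x ** \<rho> (inv\<^bsub>G\<^esub> x) = mat 1"
  by (simp flip: rep_mult rep_one)

lemma rep_inv_left: "\<rho> (inv\<^bsub>G\<^esub> x) ** \<rho> x = mat 1"
  by (simp flip: rep_mult rep_one)

lemma smooth_rep_entry: "smooth_c (\<lambda>x. \<rho> x $ i $ j)"
  using smooth_map_bounded_linear[OF atlas bounded_linear_compose[OF bounded_linear_vec_nth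
        bounded_linear_vec_nth] rep_smooth]
  by (simp add: comp_def)

lemma smooth_det:
  fixes M :: "'g \<Rightarrow> complex^'n^'n"
  assumes "\<And>i j. smooth_c (\<lambda>x. M x $ i $ j)" shows "smooth_c (\<lambda>x. det (M x))"
  unfolding det_def
  by (intro smooth_map_sum smooth_map_mult smooth_map_prod smooth_map_const atlas assms)

text \<open>By Cramer's rule the entries of the inverse matrix are quotients of determinants in the
  entries of \<open>\<rho> x\<close>, so smoothness comes from products, sums and inverses, without
  a chain rule for the inversion map.\<close>

lemma smooth_rep_inv_entry: "smooth_c (\<lambda>x. \<rho> (inv\<^bsub>G\<^esub> x) $ i $ j)"
proof -
  have det: "det (\<rho> x) \<noteq> 0" for x
    using det_mul[of "\<rho> x" "\<rho> (inv\<^bsub>G\<^esub> x)"] by (auto simp: rep_inv_right)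
  let ?M = "\<lambda>x. \<chi> r s. if s = i then axis j 1 $ r else \<rho> x $ r $ s"
  \<comment> \<open>The j-th column of the inverse matrix solves the linear system with the j-th
    unit vector on the right.\<close>
  have "\<rho> x *v (\<rho> (inv\<^bsub>G\<^esub> x) *v axis j 1) = axis j 1" for x
    by (simp add: matrix_vector_mul_assoc rep_inv_right)
  then have "\<rho> (inv\<^bsub>G\<^esub> x) *v axis j 1 =
      (\<chi> k. det (\<chi> r s. if s = k then axis j 1 $ r else \<rho> x $ r $ s) / det (\<rho> x))" for x
    using cramer[OF det] by blast
  moreover have "(\<rho> (inv\<^bsub>G\<^esub> x) *v axis j 1) $ i = \<rho> (inv\<^bsub>G\<^esub> x) $ i $ j" for x
    by (simp add: matrix_vector_mult_def axis_def if_distrib cong: if_cong)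
  ultimately have "\<rho> (inv\<^bsub>G\<^esub> x) $ i $ j = det (?M x) * inverse (det (\<rho> x))" for x
    by (metis (no_types, lifting) vec_lambda_beta divide_inverse)
  moreover have "smooth_c (\<lambda>x. if s = i then axis j 1 $ r else \<rho> x $ r $ s)" for r s
    by (cases "s = i") (simp_all add: smooth_rep_entry smooth_map_const atlas)
  then have "smooth_c (\<lambda>x. det (?M x))"
    by (intro smooth_det) simp
  then have "smooth_c (\<lambda>x. det (?M x) * inverse (det (\<rho> x)))"
    by (rule smooth_map_mult[OF atlas _ smooth_map_inverse[OF atlas det smooth_det[OF smooth_rep_entry]]])
  ultimately show ?thesis by presburger
qed

lemma separable_sum:
  assumes "\<And>i. i \<in> S \<Longrightarrow> separable (F i)"
  shows "separable (\<lambda>x y. \<Sum>i\<in>S. F i x y)"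
  using assms
proof (induction S rule: infinite_finite_induct)
  case empty
  then show ?case using separable.product[OF continuous_on_const smooth_map_const[OF atlas], of 0 0] by simp
next
  case (infinite S)
  then show ?case using separable.product[OF continuous_on_const smooth_map_const[OF atlas], of 0 0] by simp
qed (auto intro: separable.add)

text \<open>The formula for a matrix product writes each entry of
  \<open>\<rho> (x \<otimes> y)\<close> as a finite sum of an entry at x times an entry at
  y.\<close>

lemma representative_rep: "representative (\<lambda>x. \<rho> x $ i $ j)"
  unfolding representative_def rep_mult
  by (auto simp: matrix_matrix_mult_def intro!: separable_sum separable.product smooth_rep_entry
      smooth_c_continuous)

lemma representative_rep_inv: "representative (\<lambda>x. \<rho> (inv\<^bsub>G\<^esub> x) $ i $ j)"
proof -
  have "\<rho> (inv\<^bsub>G\<^esub> (x \<otimes>\<^bsub>G\<^esub> y)) $ i $ j =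
      (\<Sum>k\<in>UNIV. \<rho> (inv\<^bsub>G\<^esub> x) $ k $ j * \<rho> (inv\<^bsub>G\<^esub> y) $ i $ k)" for x y
    by (simp add: inv_mult_group rep_mult matrix_matrix_mult_def mult.commute)
  then show ?thesis
    unfolding representative_def
    by (auto intro!: separable_sum separable.product smooth_rep_inv_entry smooth_c_continuous)
qed

section \<open>Loop words and segments as matrix products\<close>

lemma rep_loop_word:
  "\<rho> (loop_word G l g) = mat_prod (map (\<lambda>(c, \<sigma>). \<rho> c ** \<rho> (g [^]\<^bsub>G\<^esub> \<sigma>)) l)"
  by (induction l) (auto simp: loop_word_def rep_one rep_mult)

lemma rep_loop_word_nth:
  "\<rho> (loop_word G (map (nth l) is) g) = mat_prod (map (letter \<rho> l g) is)"
  by (simp add: rep_loop_word letter_def[abs_def] comp_def case_prod_beta')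

lemma wilson_loop_eq: "wilson_loop G \<rho> l g = trace (mat_prod (map (letter \<rho> l g) [0..<length l]))"
  unfolding wilson_loop_def rep_loop_word_nth[symmetric] map_nth ..

text \<open>Writing the loop as the image of its list of positions lets \<open>take\<close> and
  \<open>rotate\<close> act on positions, where \<open>arc_less\<close> and \<open>arc_ge\<close>
  apply.\<close>

lemma loop_segment_eq:
  "loop_segment G \<rho> l a b g =
     mat_prod (map (letter \<rho> l g)
       (take ((b + length l - Suc a) mod length l) (rotate (Suc a) [0..<length l]))) ** \<rho> (fst (l ! b))"
  unfolding loop_segment_def rep_mult rep_loop_word_nth[symmetric]
  by (simp only: take_map[symmetric] rotate_map[symmetric] map_nth)

text \<open>Cyclicity of the trace moves the factors after position \<open>j\<close> to the front.
  What then precedes \<open>M j\<close>, including the group element of the j-th factor, is exactly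
  the full-cycle segment.\<close>

lemma trace_replace_one:
  assumes "j < length l"
  shows "trace (mat_prod (map (\<lambda>i. if i = j then \<rho> (fst (l ! i)) ** M i else letter \<rho> l g i) [0..<length l])) =
     trace (loop_segment G \<rho> l j j g ** M j)"
proof -
  let ?f = "\<lambda>i. if i = j then \<rho> (fst (l ! i)) ** M i else letter \<rho> l g i"
  have "map ?f [0..<length l] =
      map (letter \<rho> l g) [0..<j] @ (\<rho> (fst (l ! j)) ** M j) # map (letter \<rho> l g) [Suc j..<length l]"
    using assms by (simp add: upt_split[of 0 j "length l"])
  then have eq: "mat_prod (map ?f [0..<length l]) =
      (mat_prod (map (letter \<rho> l g) [0..<j]) ** (\<rho> (fst (l ! j)) ** M j)) **
        mat_prod (map (letter \<rho> l g) [Suc j..<length l])"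
    by (simp add: matrix_mul_assoc)
  have "trace (mat_prod (map ?f [0..<length l])) =
      trace (mat_prod (map (letter \<rho> l g) [Suc j..<length l]) **
        (mat_prod (map (letter \<rho> l g) [0..<j]) ** (\<rho> (fst (l ! j)) ** M j)))"
    unfolding eq by (rule trace_mul_sym)
  then show ?thesis
    unfolding loop_segment_eq arc_ge[OF order_refl assms]
    by (simp add: matrix_mul_assoc)
qed

text \<open>Cutting the cycle at \<open>i\<close> and \<open>j\<close> leaves two arcs. The one from
  \<open>j\<close> to \<open>i\<close> wraps around and is assembled by cyclicity of the
  trace.\<close>

lemma trace_replace_two_less:
  assumes "i < j" "j < length l"
  shows "trace (mat_prod (map (\<lambda>k. if k = i \<or> k = j then \<rho> (fst (l ! k)) ** M k else letter \<rho> l g k)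
       [0..<length l])) =
     trace (loop_segment G \<rho> l j i g ** M i ** loop_segment G \<rho> l i j g ** M j)"
proof -
  let ?f = "\<lambda>k. if k = i \<or> k = j then \<rho> (fst (l ! k)) ** M k else letter \<rho> l g k"
  have "[0..<length l] = [0..<i] @ i # [Suc i..<j] @ j # [Suc j..<length l]"
    using assms upt_split[of 0 i "length l"] upt_split[of "Suc i" j "length l"] by simp
  then have "map ?f [0..<length l] =
      map (letter \<rho> l g) [0..<i] @ (\<rho> (fst (l ! i)) ** M i) # map (letter \<rho> l g) [Suc i..<j] @
        (\<rho> (fst (l ! j)) ** M j) # map (letter \<rho> l g) [Suc j..<length l]"
    using assms by simp
  then have eq: "mat_prod (map ?f [0..<length l]) =
      (mat_prod (map (letter \<rho> l g) [0..<i]) ** (\<rho> (fst (l ! i)) ** M i) **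
        mat_prod (map (letter \<rho> l g) [Suc i..<j]) ** (\<rho> (fst (l ! j)) ** M j)) **
        mat_prod (map (letter \<rho> l g) [Suc j..<length l])"
    by (simp add: matrix_mul_assoc)
  have "trace (mat_prod (map ?f [0..<length l])) =
      trace (mat_prod (map (letter \<rho> l g) [Suc j..<length l]) **
        (mat_prod (map (letter \<rho> l g) [0..<i]) ** (\<rho> (fst (l ! i)) ** M i) **
        mat_prod (map (letter \<rho> l g) [Suc i..<j]) ** (\<rho> (fst (l ! j)) ** M j)))"
    unfolding eq by (rule trace_mul_sym)
  then show ?thesis
    unfolding loop_segment_eq arc_ge[OF less_imp_le[OF assms(1)] assms(2)] arc_less[OF assms]
    by (simp add: matrix_mul_assoc)
qed

lemma trace_replace_two:
  assumes "i \<noteq> j" "i < length l" "j < length l"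
  shows "trace (mat_prod (map (\<lambda>k. if k = i \<or> k = j then \<rho> (fst (l ! k)) ** M k else letter \<rho> l g k)
       [0..<length l])) =
     trace (loop_segment G \<rho> l j i g ** M i ** loop_segment G \<rho> l i j g ** M j)"
proof (cases "i < j")
  case False
  then have "j < i" using assms by simp
  have "trace ((loop_segment G \<rho> l i j g ** M j) ** (loop_segment G \<rho> l j i g ** M i)) =
     trace ((loop_segment G \<rho> l j i g ** M i) ** (loop_segment G \<rho> l i j g ** M j))"
    by (rule trace_mul_sym)
  then show ?thesis
    using trace_replace_two_less[OF \<open>j < i\<close> assms(2), of M g] by (simp add: matrix_mul_assoc disj_commute)
qed (use trace_replace_two_less assms in blast)

end

end

section \<open>Derivatives of Wilson loops\<close>

lemma is_loop_nth: "is_loop l \<Longrightarrow> i < length l \<Longrightarrow> snd (l ! i) = 1 \<or> snd (l ! i) = -1"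
  unfolding is_loop_def using nth_mem[of i l] by fastforce

section \<open>Differentiation of matrix-valued functions\<close>

context lie_group_field
begin

definition has_mat_vf :: "('g \<Rightarrow> complex^'n^'n) \<Rightarrow> ('g \<Rightarrow> complex^'n^'n) \<Rightarrow> bool" where
  "has_mat_vf M M' \<longleftrightarrow> (\<forall>i j. has_vf X (\<lambda>g. M g $ i $ j) (\<lambda>g. M' g $ i $ j))"

lemma has_mat_vf_const: "has_mat_vf (\<lambda>g. K) (\<lambda>g. 0)"
  by (simp add: has_mat_vf_def has_vf_const)

lemma has_mat_vf_mult:
  assumes "has_mat_vf M M'" "has_mat_vf N N'"
  shows "has_mat_vf (\<lambda>g. M g ** N g) (\<lambda>g. M' g ** N g + M g ** N' g)"
  using assms unfolding has_mat_vf_def matrix_matrix_mult_def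
  by (auto simp flip: sum.distrib intro!: has_vf_sum has_vf_mult)

lemma has_mat_vf_uminus: "has_mat_vf M M' \<Longrightarrow> has_mat_vf (\<lambda>g. - M g) (\<lambda>g. - M' g)"
  unfolding has_mat_vf_def using has_vf_cmult[where c = "-1"] by simp

lemma has_mat_vf_cmult_left: "has_mat_vf M M' \<Longrightarrow> has_mat_vf (\<lambda>g. K ** M g) (\<lambda>g. K ** M' g)"
  using has_mat_vf_mult[OF has_mat_vf_const] by fastforce

lemma has_mat_vf_cmult_right: "has_mat_vf M M' \<Longrightarrow> has_mat_vf (\<lambda>g. M g ** K) (\<lambda>g. M' g ** K)"
  using has_mat_vf_mult[OF _ has_mat_vf_const] by fastforce

lemma has_vf_trace: "has_mat_vf M M' \<Longrightarrow> has_vf X (\<lambda>g. trace (M g)) (\<lambda>g. trace (M' g))"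
  unfolding trace_def has_mat_vf_def by (auto intro: has_vf_sum)

lemma has_mat_vf_sum:
  "(\<And>i. i \<in> S \<Longrightarrow> has_mat_vf (M i) (M' i)) \<Longrightarrow>
    has_mat_vf (\<lambda>g. \<Sum>i\<in>S. M i g) (\<lambda>g. \<Sum>i\<in>S. M' i g)"
  unfolding has_mat_vf_def by (auto intro: has_vf_sum)

text \<open>Lets a derivative be computed in two ways and compared, as for the constant product of a
  matrix and its inverse.\<close>

lemma has_mat_vf_unique: "has_mat_vf M M' \<Longrightarrow> has_mat_vf M M'' \<Longrightarrow> M' g = M'' g"
  by (simp add: has_mat_vf_def has_vf_def vec_eq_iff)

lemma has_mat_vf_mat_prod:
  assumes "\<And>i. i < n \<Longrightarrow> has_mat_vf (f i) (f' i)"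
  shows "has_mat_vf (\<lambda>g. mat_prod (map (\<lambda>i. f i g) [0..<n]))
    (\<lambda>g. \<Sum>j<n. mat_prod (map (\<lambda>i. if i = j then f' i g else f i g) [0..<n]))"
  using assms
proof (induction n)
  case (Suc n)
  have 1: "map (\<lambda>i. if i = n then f' i g else f i g) [0..<n] = map (\<lambda>i. f i g) [0..<n]" for g
    by auto
  have "has_mat_vf (\<lambda>g. mat_prod (map (\<lambda>i. f i g) [0..<n]) ** f n g)
    (\<lambda>g. (\<Sum>j<n. mat_prod (map (\<lambda>i. if i = j then f' i g else f i g) [0..<n])) ** f n g +
      mat_prod (map (\<lambda>i. f i g) [0..<n]) ** f' n g)"
    by (rule has_mat_vf_mult) (use Suc in auto)
  then show ?case by (simp add: 1 matrix_mult_sum_left)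
qed (simp add: has_mat_vf_const)

section \<open>Derivatives of the representation and of Wilson loops\<close>

context
  fixes \<rho> :: "'g \<Rightarrow> complex^'n^'n"
  assumes rep: "lie_group_representation G A \<rho>"
begin

text \<open>Left invariance moves the evaluation to the identity, replacing \<open>\<rho> x\<close>
  by \<open>\<rho> g ** \<rho> x\<close>. The constant matrix \<open>\<rho> g\<close> comes out, and
  the remaining derivative at the identity is \<open>induced_rep\<close> by definition.\<close>

lemma has_mat_vf_rep: "has_mat_vf \<rho> (\<lambda>g. \<rho> g ** induced_rep G \<rho> X)"
  unfolding has_mat_vf_def
proof (intro allI)
  fix i j
  have "D (\<lambda>x. \<rho> x $ i $ j) g = (\<rho> g ** induced_rep G \<rho> X) $ i $ j" for g
  proof -
    have "D (\<lambda>x. \<rho> x $ i $ j) g = D (\<lambda>x. \<rho> (g \<otimes>\<^bsub>G\<^esub> x) $ i $ j) \<one>\<^bsub>G\<^esub>"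
      using D_left[OF smooth_rep_entry[OF rep]] by simp
    also have "\<dots> = D (\<lambda>x. \<Sum>k\<in>UNIV. \<rho> g $ i $ k * \<rho> x $ k $ j) \<one>\<^bsub>G\<^esub>"
      by (simp add: rep_mult[OF rep] matrix_matrix_mult_def)
    also have "\<dots> = (\<Sum>k\<in>UNIV. \<rho> g $ i $ k * D (\<lambda>x. \<rho> x $ k $ j) \<one>\<^bsub>G\<^esub>)"
    proof -
      have "has_vf X (\<lambda>x. \<rho> x $ k $ j) (D (\<lambda>x. \<rho> x $ k $ j))" for k
        using representative_rep[OF rep] by (simp add: has_vf_def)
      then have "has_vf X (\<lambda>x. \<Sum>k\<in>UNIV. \<rho> g $ i $ k * \<rho> x $ k $ j)
          (\<lambda>x. \<Sum>k\<in>UNIV. \<rho> g $ i $ k * D (\<lambda>x. \<rho> x $ k $ j) x)"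
        by (intro has_vf_sum has_vf_cmult)
      then show ?thesis by (simp add: has_vf_def)
    qed
    also have "\<dots> = (\<rho> g ** induced_rep G \<rho> X) $ i $ j"
      by (simp add: matrix_matrix_mult_def induced_rep_def vf_apply_def)
    finally show ?thesis .
  qed
  then show "has_vf X (\<lambda>g. \<rho> g $ i $ j) (\<lambda>g. (\<rho> g ** induced_rep G \<rho> X) $ i $ j)"
    using representative_rep[OF rep] by (simp add: has_vf_def)
qed

lemma has_mat_vf_rep_inv:
  "has_mat_vf (\<lambda>g. \<rho> (inv\<^bsub>G\<^esub> g)) (\<lambda>g. - (induced_rep G \<rho> X ** \<rho> (inv\<^bsub>G\<^esub> g)))"
proof -
  let ?\<xi> = "induced_rep G \<rho> X"
  \<comment> \<open>The derivative exists because the entries are representative; only its value is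
    unknown so far.\<close>
  define N where "N g = (\<chi> i j. D (\<lambda>g. \<rho> (inv\<^bsub>G\<^esub> g) $ i $ j) g)" for g
  have N: "has_mat_vf (\<lambda>g. \<rho> (inv\<^bsub>G\<^esub> g)) N"
    using representative_rep_inv[OF rep] by (simp add: has_mat_vf_def has_vf_def N_def)
  \<comment> \<open>The product of \<open>\<rho> g\<close> and its inverse is constant, so the
    Leibniz rule gives a linear equation for \<open>N g\<close>.\<close>
  have "\<rho> g ** ?\<xi> ** \<rho> (inv\<^bsub>G\<^esub> g) + \<rho> g ** N g = 0" for g
    using has_mat_vf_unique[OF has_mat_vf_mult[OF has_mat_vf_rep N], of "\<lambda>g. 0"] has_mat_vf_const[of "mat 1"]
    by (simp add: rep_inv_right[OF rep])
  then have "\<rho> (inv\<^bsub>G\<^esub> g) ** (\<rho> g ** (?\<xi> ** \<rho> (inv\<^bsub>G\<^esub> g) + N g)) = \<rho> (inv\<^bsub>G\<^esub> g) ** 0" for g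
    by (simp add: matrix_add_ldistrib matrix_mul_assoc)
  then have "?\<xi> ** \<rho> (inv\<^bsub>G\<^esub> g) + N g = 0" for g
    unfolding matrix_mul_assoc[of "\<rho> _" "\<rho> _"] rep_inv_left[OF rep] matrix_mul_lid
    by (simp add: matrix_matrix_mult_def vec_eq_iff)
  then have "N = (\<lambda>g. - (?\<xi> ** \<rho> (inv\<^bsub>G\<^esub> g)))"
    by (metis (no_types) eq_neg_iff_add_eq_0 add.commute)
  then show ?thesis using N by simp
qed

lemma has_mat_vf_rep_pow:
  "\<sigma> = 1 \<or> \<sigma> = -1 \<Longrightarrow> has_mat_vf (\<lambda>g. \<rho> (g [^]\<^bsub>G\<^esub> \<sigma>)) (insertion G \<rho> X \<sigma>)"
  using has_mat_vf_rep has_mat_vf_rep_inv int_pow_neg[of _ 1]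
  by (auto simp: insertion_def[abs_def])

lemma has_mat_vf_letter:
  assumes "snd (l ! i) = 1 \<or> snd (l ! i) = -1"
  shows "has_mat_vf (\<lambda>g. letter \<rho> l g i) (\<lambda>g. letter' \<rho> l X g i)"
  unfolding letter_def letter'_def by (intro has_mat_vf_cmult_left has_mat_vf_rep_pow assms)

lemma has_mat_vf_letter':
  assumes "snd (l ! i) = 1 \<or> snd (l ! i) = -1"
  shows "has_mat_vf (\<lambda>g. letter' \<rho> l X g i) (\<lambda>g. letter'' \<rho> l X g i)"
proof -
  have "has_mat_vf (\<lambda>g. - (induced_rep G \<rho> X ** \<rho> (inv\<^bsub>G\<^esub> g)))
      (\<lambda>g. - (induced_rep G \<rho> X ** (- (induced_rep G \<rho> X ** \<rho> (inv\<^bsub>G\<^esub> g)))))"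
    by (intro has_mat_vf_uminus has_mat_vf_cmult_left has_mat_vf_rep_inv)
  moreover have "- (K ** (- (K ** M))) = (K ** K) ** M" for K M :: "complex^'n^'n"
    by (simp add: matrix_mul_assoc[symmetric]) (simp add: matrix_matrix_mult_def vec_eq_iff sum_negf)
  ultimately show ?thesis
    using assms has_mat_vf_cmult_right[OF has_mat_vf_rep, of "induced_rep G \<rho> X"]
    unfolding letter'_def letter''_def insertion_def
    by (auto intro!: has_mat_vf_cmult_left simp: matrix_mul_assoc)
qed

lemma wilson'_eq:
  "wilson' \<rho> l X g = (\<Sum>j<length l. trace (mat_prod (map (\<lambda>i. if i = j then letter' \<rho> l X g i
     else letter \<rho> l g i) [0..<length l])))"
  unfolding wilson'_def letter'_def
  by (intro sum.cong refl trace_replace_one[OF rep, symmetric]) simp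

lemma has_vf_wilson_loop:
  assumes "is_loop l"
  shows "has_vf X (wilson_loop G \<rho> l) (wilson' \<rho> l X)"
proof -
  have "has_vf X (\<lambda>g. trace (mat_prod (map (letter \<rho> l g) [0..<length l]))) (wilson' \<rho> l X)"
    unfolding wilson'_eq[abs_def] trace_sum[symmetric]
    by (intro has_vf_trace has_mat_vf_mat_prod has_mat_vf_letter is_loop_nth assms)
  then show ?thesis by (simp add: wilson_loop_eq[OF rep, abs_def])
qed

text \<open>Differentiating the sum over \<open>j\<close> again yields a sum over all pairs j, j'.
  The diagonal pairs produce \<open>letter''\<close>, the others two separate insertions, which
  \<open>trace_replace_two\<close> rewrites with loop segments.\<close>

lemma has_vf_wilson':
  assumes "is_loop l"
  shows "has_vf X (wilson' \<rho> l X) (wilson'' \<rho> l X)"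
proof -
  let ?n = "length l"
  let ?f = "\<lambda>j i g. if i = j then letter' \<rho> l X g i else letter \<rho> l g i"
  let ?f' = "\<lambda>j i g. if i = j then letter'' \<rho> l X g i else letter' \<rho> l X g i"
  let ?t = "\<lambda>j j' g. trace (mat_prod (map (\<lambda>i. if i = j' then ?f' j i g else ?f j i g) [0..<?n]))"
  have "has_mat_vf (?f j i) (?f' j i)" if "i < ?n" for i j
    using has_mat_vf_letter[OF is_loop_nth[OF assms that]]
      has_mat_vf_letter'[OF is_loop_nth[OF assms that]] by (cases "i = j") simp_all
  then have vf: "has_vf X (wilson' \<rho> l X) (\<lambda>g. \<Sum>j<?n. \<Sum>j'<?n. ?t j j' g)"
    unfolding wilson'_eq[abs_def] trace_sum[symmetric]
    by (intro has_vf_trace has_mat_vf_sum has_mat_vf_mat_prod) auto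
  have eq: "(\<Sum>j<?n. \<Sum>j'<?n. ?t j j' g) = wilson'' \<rho> l X g" for g
    unfolding wilson''_def
  proof (rule sum.cong)
    fix j assume "j \<in> {..<?n}"
    then have j: "j < ?n" by simp
    have "?t j j' g = trace (loop_segment G \<rho> l j' j g ** insertion G \<rho> X (snd (l ! j)) g **
        loop_segment G \<rho> l j j' g ** insertion G \<rho> X (snd (l ! j')) g)" if "j' \<in> {..<?n} - {j}" for j'
    proof -
      have "?t j j' g = trace (mat_prod (map (\<lambda>k. if k = j \<or> k = j'
          then letter' \<rho> l X g k else letter \<rho> l g k) [0..<?n]))"
        using that by (intro arg_cong[of _ _ trace] arg_cong[of _ _ mat_prod] map_cong) auto
      then show ?thesis
        unfolding letter'_def using that j trace_replace_two[OF rep, of j j' l] by simp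
    qed
    moreover have "?t j j g = trace (mat_prod (map (\<lambda>i. if i = j then letter'' \<rho> l X g i
        else letter \<rho> l g i) [0..<?n]))"
      by (intro arg_cong[of _ _ trace] arg_cong[of _ _ mat_prod]) simp
    ultimately show "(\<Sum>j'<?n. ?t j j' g) =
        trace (mat_prod (map (\<lambda>i. if i = j then letter'' \<rho> l X g i else letter \<rho> l g i) [0..<?n])) +
        (\<Sum>j'\<in>{..<?n} - {j}. trace (loop_segment G \<rho> l j' j g ** insertion G \<rho> X (snd (l ! j)) g **
          loop_segment G \<rho> l j j' g ** insertion G \<rho> X (snd (l ! j')) g))"
      using j by (simp add: sum.remove[of "{..<?n}" j])
  qed simp
  show ?thesis using vf unfolding eq .
qed

end

end

section \<open>Sums over the basis: merging, Casimir and twisting\<close>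

context haar_lie_group
begin

text \<open>Identifies the total merger as the pairing of the gradients of two loops, which is how
  it enters the calculation.\<close>

lemma sum_wilson':
  "(\<Sum>a\<in>I. wilson' \<rho> l (\<xi> a) g * wilson' \<rho> l' (\<xi> a) g) = total_merger G \<rho> I \<xi> l l' g"
  unfolding wilson'_def total_merger_def merging_at_def sum_product
  by (subst sum.swap, intro sum.cong refl, subst sum.swap, rule refl)

context
  fixes \<rho> :: "'g \<Rightarrow> complex^'n^'n" and I :: "'i set" and \<xi> and lam
  assumes rep: "lie_group_representation G A \<rho>"
    and \<xi>: "\<xi> ` I \<subseteq> lie_algebra G A"
    and casimir: "casimir_rep G \<rho> I \<xi> = mat lam"
begin

text \<open>The sum over the basis assembles the Casimir, which is scalar and so commutes with
  \<open>\<rho> g\<close>. Therefore both signs lead to the same expression.\<close>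

lemma sum_letter'':
  assumes "snd (l ! i) = 1 \<or> snd (l ! i) = -1"
  shows "(\<Sum>a\<in>I. letter'' \<rho> l (\<xi> a) g i) = \<rho> (fst (l ! i)) ** (mat lam ** \<rho> (g [^]\<^bsub>G\<^esub> snd (l ! i)))"
proof -
  have "\<rho> g ** mat lam = mat lam ** \<rho> g"
    by (simp add: matrix_matrix_mult_def mat_def vec_eq_iff if_distrib if_distribR mult.commute cong: if_cong)
  then show ?thesis
    using assms int_pow_neg[of g 1] casimir unfolding letter''_def casimir_rep_def
    by (auto simp flip: matrix_mult_sum_left matrix_mult_sum_right)
qed

text \<open>Each position contributes one diagonal term, equal to the eigenvalue times the loop,
  whence the factor \<open>length l\<close>. The off-diagonal terms sum to the twisting by
  definition.\<close>

lemma sum_wilson'':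
  assumes "is_loop l"
  shows "(\<Sum>a\<in>I. wilson'' \<rho> l (\<xi> a) g) =
    lam * of_nat (length l) * wilson_loop G \<rho> l g + total_twisting G \<rho> I \<xi> l g"
proof -
  let ?n = "length l"
  let ?M = "\<lambda>a j. mat_prod (map (\<lambda>i. if i = j then letter'' \<rho> l (\<xi> a) g i else letter \<rho> l g i) [0..<?n])"
  have diag: "(\<Sum>a\<in>I. trace (?M a j)) = lam * wilson_loop G \<rho> l g" if j: "j < ?n" for j
  proof -
    let ?p = "mat_prod (map (letter \<rho> l g) [0..<j])"
    let ?s = "mat_prod (map (letter \<rho> l g) [Suc j..<?n])"
    \<comment> \<open>Used twice: with the second derivative at position \<open>j\<close>, and with
      the plain letter to reassemble the loop.\<close>
    have split: "mat_prod (map f [0..<?n]) = (?p ** f j) ** ?s"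
      if "\<And>i. i \<noteq> j \<Longrightarrow> f i = letter \<rho> l g i" for f
    proof -
      have "map f [0..<?n] = map (letter \<rho> l g) [0..<j] @ f j # map (letter \<rho> l g) [Suc j..<?n]"
        using j that by (simp add: upt_split[of 0 j ?n])
      then show ?thesis by (simp add: matrix_mul_assoc)
    qed
    have "?M a j = ?p ** letter'' \<rho> l (\<xi> a) g j ** ?s" for a
      by (subst split) simp_all
    then have "(\<Sum>a\<in>I. trace (?M a j)) = trace (?p ** (\<Sum>a\<in>I. letter'' \<rho> l (\<xi> a) g j) ** ?s)"
      by (simp add: trace_sum matrix_mult_sum_left matrix_mult_sum_right)
    also have "\<dots> = lam * trace (?p ** letter \<rho> l g j ** ?s)"
      unfolding sum_letter''[OF is_loop_nth[OF assms j]] letter_def[of \<rho> l g j]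
      using trace_mat_mult[of "?p ** \<rho> (fst (l ! j))" lam "\<rho> (g [^]\<^bsub>G\<^esub> snd (l ! j)) ** ?s"]
      by (simp add: matrix_mul_assoc)
    also have "?p ** letter \<rho> l g j ** ?s = mat_prod (map (letter \<rho> l g) [0..<?n])"
      by (subst split) simp_all
    finally show ?thesis by (simp add: wilson_loop_eq[OF rep])
  qed
  have "(\<Sum>a\<in>I. wilson'' \<rho> l (\<xi> a) g) = (\<Sum>j<?n. \<Sum>a\<in>I. trace (?M a j)) +
     (\<Sum>j<?n. \<Sum>j'\<in>{..<?n} - {j}. twisting_at G \<rho> I \<xi> l j j' g)"
    unfolding wilson''_def twisting_at_def
    by (subst sum.swap) (simp add: sum.distrib sum.swap[of _ I])
  then show ?thesis by (simp add: diag total_twisting_def)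
qed

end

end

section \<open>The loop equation\<close>

text \<open>The Leibniz rule produces ordered pairs of distinct loops, the loop equation counts r <
  s; this is the source of the factor 2 before the merger.\<close>

lemma sum_off_diagonal:
  fixes f :: "nat \<Rightarrow> nat \<Rightarrow> complex"
  assumes "\<And>r s. f r s = f s r"
  shows "(\<Sum>r<q. \<Sum>s\<in>{..<q} - {r}. f r s) = 2 * (\<Sum>r<q. \<Sum>s\<in>{r<..<q}. f r s)"
proof -
  have "(\<Sum>s\<in>{..<q} - {r}. f r s) = (\<Sum>s\<in>{..<r}. f r s) + (\<Sum>s\<in>{r<..<q}. f r s)" if "r < q" for r
  proof -
    have eq: "{..<q} - {r} = {..<r} \<union> {r<..<q}" using that by auto
    show ?thesis unfolding eq by (rule sum.union_disjoint) auto
  qed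
  moreover have "(\<Sum>r<q. \<Sum>s\<in>{..<r}. f r s) = (\<Sum>r<q. \<Sum>s\<in>{r<..<q}. f r s)"
  proof -
    \<comment> \<open>Exchanging the coordinates maps the pairs below the diagonal to those above
      it.\<close>
    have "(\<Sum>r<q. \<Sum>s\<in>{..<r}. f r s) = (\<Sum>s<q. \<Sum>r\<in>{s<..<q}. f r s)"
      by (subst sum.Sigma; (subst sum.Sigma)?; (simp; fail)?)
        (rule sum.reindex_bij_witness[of _ prod.swap prod.swap]; auto)
    then show ?thesis by (simp add: assms)
  qed
  ultimately show ?thesis by (simp add: sum.distrib)
qed

section \<open>Continuity of loops, mergers and twistings, needed for integrability\<close>

context haar_lie_group
begin

lemma total_merger_commute: "total_merger G \<rho> I \<xi> l l' g = total_merger G \<rho> I \<xi> l' l g"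
  unfolding sum_wilson'[symmetric] by (simp add: mult.commute)

lemma continuous_wilson_loop:
  fixes \<rho> :: "'g \<Rightarrow> complex^'n^'n"
  assumes rep: "lie_group_representation G A \<rho>"
  shows "continuous_on UNIV (wilson_loop G \<rho> l)"
proof -
  have c: "continuous_on UNIV (\<lambda>g. loop_word G l g)"
  proof (induction l)
    case (Cons p l)
    have "continuous_on UNIV (\<lambda>g. g [^]\<^bsub>G\<^esub> snd p)"
    proof -
      have n: "continuous_on UNIV (\<lambda>g. g [^]\<^bsub>G\<^esub> (n::nat))" for n
        by (induction n) (simp_all add: continuous_mult)
      show ?thesis
        unfolding int_pow_def2
        by (cases "snd p < 0"; simp only: if_True if_False; intro continuous_inv n)
    qed
    then have "continuous_on UNIV (\<lambda>g. fst p \<otimes>\<^bsub>G\<^esub> (g [^]\<^bsub>G\<^esub> snd p) \<otimes>\<^bsub>G\<^esub> loop_word G l g)"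
      by (intro continuous_mult continuous_on_const Cons)
    then show ?case by (simp add: loop_word_def case_prod_beta)
  qed (simp add: loop_word_def)
  have "continuous_on UNIV \<rho>" using rep_smooth[OF rep] by (simp add: smooth_map_def)
  from continuous_on_compose2[OF this c] show ?thesis
    unfolding wilson_loop_def[abs_def] trace_def by (intro continuous_intros) simp
qed

context
  fixes \<rho> :: "'g \<Rightarrow> complex^'n^'n" and I :: "'i set" and \<xi> and lam
  assumes rep: "lie_group_representation G A \<rho>"
    and \<xi>: "\<xi> ` I \<subseteq> lie_algebra G A"
    and casimir: "casimir_rep G \<rho> I \<xi> = mat lam"
begin

lemma field: "a \<in> I \<Longrightarrow> lie_group_field G A \<mu> (\<xi> a)"
  using \<xi> by unfold_locales auto

lemma continuous_total_merger:
  assumes "is_loop l" "is_loop l'" shows "continuous_on UNIV (total_merger G \<rho> I \<xi> l l')"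
proof -
  have "continuous_on UNIV (wilson' \<rho> l (\<xi> a))" if "is_loop l" "a \<in> I" for a l
    using lie_group_field.has_vf_continuous[OF field lie_group_field.has_vf_wilson_loop[OF field rep]] that
    by blast
  then show ?thesis
    unfolding sum_wilson'[symmetric] using assms by (intro continuous_intros) simp_all
qed

text \<open>By \<open>sum_wilson''\<close> the twisting is a sum of second derivatives minus a
  multiple of the loop, and these are continuous.\<close>

lemma continuous_total_twisting:
  assumes "is_loop l" shows "continuous_on UNIV (total_twisting G \<rho> I \<xi> l)"
proof -
  have "continuous_on UNIV (wilson'' \<rho> l (\<xi> a))" if "a \<in> I" for a
    using lie_group_field.has_vf_continuous[OF field lie_group_field.has_vf_wilson'[OF field rep]] that assms
    by blast
  moreover have "total_twisting G \<rho> I \<xi> l =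
      (\<lambda>g. (\<Sum>a\<in>I. wilson'' \<rho> l (\<xi> a) g) - lam * of_nat (length l) * wilson_loop G \<rho> l g)"
    using sum_wilson''[OF rep \<xi> casimir assms] by auto
  ultimately show ?thesis
    by (simp only:) (intro continuous_intros continuous_wilson_loop[OF rep]; blast)
qed

text \<open>The sum of \<open>second_order_by_parts\<close> over the basis, for the product of the
  loops and the action \<open>S\<close>. The normalization is left out and each side remains a
  single integral.\<close>

lemma wilson_loop_equation:
  fixes q :: nat and \<beta> :: complex and l :: "nat \<Rightarrow> 'g loop" and P :: "'p set" and C :: "'p \<Rightarrow> 'g" and \<epsilon> :: "'p \<Rightarrow> int"
  defines "W \<equiv> \<lambda>k. wilson_loop G \<rho> (l k)"
    and "S \<equiv> \<lambda>g. \<beta> * (\<Sum>p\<in>P. wilson_loop G \<rho> [(C p, \<epsilon> p)] g)"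
  assumes l: "\<And>r. r < q \<Longrightarrow> is_loop (l r)"
    and \<epsilon>: "\<And>p. p \<in> P \<Longrightarrow> \<epsilon> p = 1 \<or> \<epsilon> p = -1"
  shows "(\<integral>g. ((\<Sum>r<q. (lam * of_nat (length (l r)) * W r g + total_twisting G \<rho> I \<xi> (l r) g) *
              (\<Prod>k\<in>{..<q} - {r}. W k g)) +
            2 * (\<Sum>r<q. \<Sum>s\<in>{r<..<q}. total_merger G \<rho> I \<xi> (l r) (l s) g *
              (\<Prod>k\<in>{..<q} - {r, s}. W k g))) * exp (S g) \<partial>\<mu>) =
    (\<integral>g. (\<Prod>k<q. W k g) * (\<beta> * lam * (\<Sum>p\<in>P. wilson_loop G \<rho> [(C p, \<epsilon> p)] g) +
        \<beta>\<^sup>2 * (\<Sum>p\<in>P. \<Sum>p'\<in>P. total_merger G \<rho> I \<xi> [(C p, \<epsilon> p)] [(C p', \<epsilon> p')] g)) * exp (S g) \<partial>\<mu>)"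
proof -
  define w where "w p = [(C p, \<epsilon> p)]" for p
  have w: "is_loop (w p)" if "p \<in> P" for p using \<epsilon>[OF that] by (auto simp: is_loop_def w_def)
  define F where "F g = (\<Prod>k<q. W k g)" for g
  define F1 where "F1 a g = (\<Sum>r<q. wilson' \<rho> (l r) (\<xi> a) g * (\<Prod>k\<in>{..<q} - {r}. W k g))" for a g
  \<comment> \<open>The inner sum differentiates the product from which loop \<open>r\<close> has
    already been removed, so no loop is differentiated twice there.\<close>
  define F2 where "F2 a g = (\<Sum>r<q. wilson'' \<rho> (l r) (\<xi> a) g * (\<Prod>k\<in>{..<q} - {r}. W k g) +
    wilson' \<rho> (l r) (\<xi> a) g * (\<Sum>s\<in>{..<q} - {r}. wilson' \<rho> (l s) (\<xi> a) g *
      (\<Prod>k\<in>{..<q} - {r} - {s}. W k g)))" for a g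
  define S1 where "S1 a g = \<beta> * (\<Sum>p\<in>P. wilson' \<rho> (w p) (\<xi> a) g)" for a g
  define S2 where "S2 a g = \<beta> * (\<Sum>p\<in>P. wilson'' \<rho> (w p) (\<xi> a) g)" for a g
  have vf: "has_vf (\<xi> a) F (F1 a)" "has_vf (\<xi> a) (F1 a) (F2 a)"
    "has_vf (\<xi> a) S (S1 a)" "has_vf (\<xi> a) (S1 a) (S2 a)" if "a \<in> I" for a
  proof -
    interpret lie_group_field G A \<mu> "\<xi> a" using field[OF that] .
    have 1: "has_vf (\<xi> a) (W r) (wilson' \<rho> (l r) (\<xi> a))"
      "has_vf (\<xi> a) (wilson' \<rho> (l r) (\<xi> a)) (wilson'' \<rho> (l r) (\<xi> a))" if "r < q" for r
      unfolding W_def using has_vf_wilson_loop[OF rep] has_vf_wilson'[OF rep] l[OF that] by blast+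
    have 2: "has_vf (\<xi> a) (wilson_loop G \<rho> (w p)) (wilson' \<rho> (w p) (\<xi> a))"
      "has_vf (\<xi> a) (wilson' \<rho> (w p) (\<xi> a)) (wilson'' \<rho> (w p) (\<xi> a))" if "p \<in> P" for p
      using has_vf_wilson_loop[OF rep] has_vf_wilson'[OF rep] w[OF that] by blast+
    show "has_vf (\<xi> a) F (F1 a)"
      unfolding F_def F1_def using 1 by (intro has_vf_prod) auto
    show "has_vf (\<xi> a) (F1 a) (F2 a)"
      unfolding F1_def F2_def using 1 by (intro has_vf_sum has_vf_mult has_vf_prod) auto
    show "has_vf (\<xi> a) S (S1 a)"
      unfolding S_def S1_def w_def[symmetric] using 2 by (intro has_vf_cmult has_vf_sum) auto
    show "has_vf (\<xi> a) (S1 a) (S2 a)"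
      unfolding S1_def S2_def using 2 by (intro has_vf_cmult has_vf_sum) auto
  qed
  have c: "continuous_on UNIV (F2 a)" "continuous_on UNIV (S1 a)" "continuous_on UNIV (S2 a)"
    if "a \<in> I" for a
    using lie_group_field.has_vf_continuous[OF field[OF that]] vf[OF that] by blast+
  have cF: "continuous_on UNIV F" "continuous_on UNIV S"
    unfolding F_def S_def W_def by (intro continuous_intros continuous_wilson_loop[OF rep])+
  have F2_sum: "(\<Sum>a\<in>I. F2 a g) = (\<Sum>r<q. (lam * of_nat (length (l r)) * W r g +
        total_twisting G \<rho> I \<xi> (l r) g) * (\<Prod>k\<in>{..<q} - {r}. W k g)) +
      2 * (\<Sum>r<q. \<Sum>s\<in>{r<..<q}. total_merger G \<rho> I \<xi> (l r) (l s) g * (\<Prod>k\<in>{..<q} - {r, s}. W k g))"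
    for g
  proof -
    have D: "{..<q} - {r} - {s} = {..<q} - {r, s}" for r s by auto
    have "(\<Sum>a\<in>I. F2 a g) = (\<Sum>r<q. (\<Sum>a\<in>I. wilson'' \<rho> (l r) (\<xi> a) g) * (\<Prod>k\<in>{..<q} - {r}. W k g)) +
       (\<Sum>r<q. \<Sum>s\<in>{..<q} - {r}. (\<Sum>a\<in>I. wilson' \<rho> (l r) (\<xi> a) g * wilson' \<rho> (l s) (\<xi> a) g) *
          (\<Prod>k\<in>{..<q} - {r, s}. W k g))"
      unfolding F2_def D
      by (simp add: sum.distrib sum_distrib_left sum_distrib_right mult.assoc sum.swap[of _ I])
    also have "(\<Sum>r<q. (\<Sum>a\<in>I. wilson'' \<rho> (l r) (\<xi> a) g) * (\<Prod>k\<in>{..<q} - {r}. W k g)) =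
        (\<Sum>r<q. (lam * of_nat (length (l r)) * W r g + total_twisting G \<rho> I \<xi> (l r) g) *
          (\<Prod>k\<in>{..<q} - {r}. W k g))"
      by (intro sum.cong refl) (simp add: sum_wilson''[OF rep \<xi> casimir l] W_def)
    also have "(\<Sum>r<q. \<Sum>s\<in>{..<q} - {r}. (\<Sum>a\<in>I. wilson' \<rho> (l r) (\<xi> a) g * wilson' \<rho> (l s) (\<xi> a) g) *
          (\<Prod>k\<in>{..<q} - {r, s}. W k g)) =
        2 * (\<Sum>r<q. \<Sum>s\<in>{r<..<q}. total_merger G \<rho> I \<xi> (l r) (l s) g * (\<Prod>k\<in>{..<q} - {r, s}. W k g))"
      unfolding sum_wilson'
      by (rule sum_off_diagonal) (simp add: total_merger_commute insert_commute)
    finally show ?thesis .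
  qed
  have S_sum: "(\<Sum>a\<in>I. S2 a g + S1 a g * S1 a g) =
      \<beta> * lam * (\<Sum>p\<in>P. wilson_loop G \<rho> (w p) g) +
      \<beta>\<^sup>2 * (\<Sum>p\<in>P. \<Sum>p'\<in>P. total_merger G \<rho> I \<xi> (w p) (w p') g)" for g
  proof -
    have "(\<Sum>a\<in>I. S2 a g) = \<beta> * (\<Sum>p\<in>P. \<Sum>a\<in>I. wilson'' \<rho> (w p) (\<xi> a) g)"
      unfolding S2_def sum_distrib_left[symmetric] by (subst sum.swap) (rule refl)
    \<comment> \<open>A loop with one factor has length 1 and no two distinct positions: its
      twisting is zero and only the Casimir term remains.\<close>
    also have "\<dots> = \<beta> * (\<Sum>p\<in>P. lam * wilson_loop G \<rho> (w p) g)"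
      by (intro arg_cong2[of _ _ _ _ "(*)"] sum.cong refl)
        (simp add: sum_wilson''[OF rep \<xi> casimir w], simp add: w_def total_twisting_def lessThan_Suc)
    finally have "(\<Sum>a\<in>I. S2 a g) = \<beta> * lam * (\<Sum>p\<in>P. wilson_loop G \<rho> (w p) g)"
      by (simp add: sum_distrib_left mult.assoc)
    \<comment> \<open>Squaring the first derivative of the action gives all ordered pairs (p, p'),
      including the diagonal.\<close>
    moreover have "(\<Sum>a\<in>I. S1 a g * S1 a g) =
        (\<Sum>a\<in>I. \<Sum>p\<in>P. \<Sum>p'\<in>P. \<beta>\<^sup>2 * (wilson' \<rho> (w p) (\<xi> a) g * wilson' \<rho> (w p') (\<xi> a) g))"
    proof (intro sum.cong refl)
      fix a
      have "S1 a g * S1 a g =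
          \<beta>\<^sup>2 * ((\<Sum>p\<in>P. wilson' \<rho> (w p) (\<xi> a) g) * (\<Sum>p\<in>P. wilson' \<rho> (w p) (\<xi> a) g))"
        by (simp add: S1_def power2_eq_square)
      then show "S1 a g * S1 a g =
          (\<Sum>p\<in>P. \<Sum>p'\<in>P. \<beta>\<^sup>2 * (wilson' \<rho> (w p) (\<xi> a) g * wilson' \<rho> (w p') (\<xi> a) g))"
        by (simp only: sum_product) (simp only: sum_distrib_left)
    qed
    moreover have "\<dots> = \<beta>\<^sup>2 * (\<Sum>p\<in>P. \<Sum>p'\<in>P. total_merger G \<rho> I \<xi> (w p) (w p') g)"
      unfolding sum_wilson'[symmetric] sum_distrib_left
      by (subst sum.swap, intro sum.cong refl, rule sum.swap)
    ultimately show ?thesis by (simp add: sum.distrib)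
  qed
  have "(\<integral>g. (\<Sum>a\<in>I. F2 a g) * exp (S g) \<partial>\<mu>) = (\<Sum>a\<in>I. \<integral>g. F2 a g * exp (S g) \<partial>\<mu>)"
    unfolding sum_distrib_right using c cF
    by (intro Bochner_Integration.integral_sum integrable_continuous continuous_intros)
  also have "\<dots> = (\<Sum>a\<in>I. \<integral>g. F g * (S2 a g + S1 a g * S1 a g) * exp (S g) \<partial>\<mu>)"
  proof (rule sum.cong[OF refl])
    fix a assume "a \<in> I"
    note a = lie_group_field.second_order_by_parts[OF field[OF this] vf[OF this]]
    show "(\<integral>g. F2 a g * exp (S g) \<partial>\<mu>) = (\<integral>g. F g * (S2 a g + S1 a g * S1 a g) * exp (S g) \<partial>\<mu>)"
      by (rule a)
  qed
  also have "\<dots> = (\<integral>g. F g * (\<Sum>a\<in>I. S2 a g + S1 a g * S1 a g) * exp (S g) \<partial>\<mu>)"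
    unfolding sum_distrib_right sum_distrib_left using c cF
    by (intro Bochner_Integration.integral_sum[symmetric] integrable_continuous continuous_intros)
  finally show ?thesis
    unfolding F2_sum S_sum F_def w_def .
qed

end

end

section \<open>The loop equation for the normalized density, term by term\<close>

theorem corollary3p9:
  fixes G :: "('g::{t2_space,second_countable_topology}) monoid"
    and A :: "('g, 'e::real_normed_vector) atlas"
    and \<kappa> :: "'g vector_field \<Rightarrow> 'g vector_field \<Rightarrow> real"
    and I :: "'i set" and \<xi> :: "'i \<Rightarrow> 'g vector_field"
    and \<mu> :: "'g measure"
    and \<rho> :: "'g \<Rightarrow> complex^'n^'n"
    and lam :: complex
    and q :: nat and l :: "nat \<Rightarrow> 'g loop"
    and \<beta> :: real
    and P :: "'p set" and C :: "'p \<Rightarrow> 'g" and \<epsilon> :: "'p \<Rightarrow> int"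
  assumes "compact_lie_group G A"
    and "Ad_invariant_inner_product G A \<kappa>"
    and "orthonormal_basis G A \<kappa> I \<xi>"
    and "normalized_haar_measure G \<mu>"
    and "lie_group_representation G A \<rho>"
    and "irreducible_representation \<rho>"
    and "casimir_rep G \<rho> I \<xi> = mat lam"
    and "\<forall>r<q. is_loop (l r)"
    and "finite P"
    and "\<forall>p\<in>P. \<epsilon> p = 1 \<or> \<epsilon> p = -1"
    and "wilson_partition_function G \<rho> \<mu> \<beta> P C \<epsilon> \<noteq> 0"
  shows "lam * (\<Sum>r<q. of_nat (length (l r)) *
          (\<integral>g. (\<Prod>k<q. wilson_loop G \<rho> (l k) g) * wilson_density G \<rho> \<mu> \<beta> P C \<epsilon> g \<partial>\<mu>)) =
      - 2 * (\<Sum>r<q. \<Sum>s\<in>{r<..<q}.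
          \<integral>g. total_merger G \<rho> I \<xi> (l r) (l s) g *
              (\<Prod>k\<in>{..<q} - {r, s}. wilson_loop G \<rho> (l k) g) *
              wilson_density G \<rho> \<mu> \<beta> P C \<epsilon> g \<partial>\<mu>)
      - (\<Sum>r<q.
          \<integral>g. total_twisting G \<rho> I \<xi> (l r) g *
              (\<Prod>k\<in>{..<q} - {r}. wilson_loop G \<rho> (l k) g) *
              wilson_density G \<rho> \<mu> \<beta> P C \<epsilon> g \<partial>\<mu>)
      + of_real \<beta> * lam * (\<Sum>p\<in>P.
          \<integral>g. wilson_loop G \<rho> [(C p, \<epsilon> p)] g *
              (\<Prod>k<q. wilson_loop G \<rho> (l k) g) *
              wilson_density G \<rho> \<mu> \<beta> P C \<epsilon> g \<partial>\<mu>)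
      + (of_real \<beta>)\<^sup>2 * (\<Sum>p\<in>P. \<Sum>p'\<in>P.
          \<integral>g. total_merger G \<rho> I \<xi> [(C p, \<epsilon> p)] [(C p', \<epsilon> p')] g *
              (\<Prod>k<q. wilson_loop G \<rho> (l k) g) *
              wilson_density G \<rho> \<mu> \<beta> P C \<epsilon> g \<partial>\<mu>)"
proof -
  interpret haar_lie_group G A \<mu> using assms(1,4) by unfold_locales
  have \<xi>: "\<xi> ` I \<subseteq> lie_algebra G A" using assms(3) unfolding orthonormal_basis_def by blast
  note rep = assms(5) and casimir = assms(7)
  note cont = continuous_wilson_loop[OF rep]
    continuous_total_merger[OF rep \<xi> casimir] continuous_total_twisting[OF rep \<xi> casimir]
  have l: "is_loop (l r)" if "r < q" for r using assms(8) that by blast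
  have w: "is_loop [(C p, \<epsilon> p)]" if "p \<in> P" for p using assms(10) that by (auto simp: is_loop_def)
  let ?Z = "wilson_partition_function G \<rho> \<mu> \<beta> P C \<epsilon>"
  let ?W = "\<lambda>k. wilson_loop G \<rho> (l k)"
  let ?\<nu> = "wilson_density G \<rho> \<mu> \<beta> P C \<epsilon>"
  have \<nu>: "?\<nu> g = exp (of_real \<beta> * (\<Sum>p\<in>P. wilson_loop G \<rho> [(C p, \<epsilon> p)] g)) / ?Z" for g
    by (simp add: wilson_density_def wilson_weight_def)
  have c\<nu>: "continuous_on UNIV ?\<nu>"
    unfolding wilson_density_def[abs_def] wilson_weight_def by (intro continuous_intros cont)
  define c where "c r g = (\<Prod>k\<in>{..<q} - {r}. ?W k g)" for r g
  define T where "T r g = total_twisting G \<rho> I \<xi> (l r) g * c r g * ?\<nu> g" for r g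
  define M where "M r s g = total_merger G \<rho> I \<xi> (l r) (l s) g * (\<Prod>k\<in>{..<q} - {r, s}. ?W k g) * ?\<nu> g"
    for r s g
  define U where "U p g = wilson_loop G \<rho> [(C p, \<epsilon> p)] g * (\<Prod>k<q. ?W k g) * ?\<nu> g" for p g
  define V where "V p p' g = total_merger G \<rho> I \<xi> [(C p, \<epsilon> p)] [(C p', \<epsilon> p')] g * (\<Prod>k<q. ?W k g) * ?\<nu> g"
    for p p' g
  define F where "F g = (\<Prod>k<q. ?W k g) * ?\<nu> g" for g
  have int: "integrable \<mu> F"
    "\<And>r. r < q \<Longrightarrow> integrable \<mu> (T r)" "\<And>r s. r < q \<Longrightarrow> s < q \<Longrightarrow> integrable \<mu> (M r s)"
    "\<And>p. p \<in> P \<Longrightarrow> integrable \<mu> (U p)" "\<And>p p'. p \<in> P \<Longrightarrow> p' \<in> P \<Longrightarrow> integrable \<mu> (V p p')"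
    unfolding F_def T_def M_def U_def V_def c_def
    by (intro integrable_continuous continuous_intros cont c\<nu> l w; assumption)+
  \<comment> \<open>Restores the loop left out of \<open>c r\<close>, so the Casimir part of every
    \<open>r\<close> has the same integrand \<open>F\<close>.\<close>
  have W: "?W r g * c r g = (\<Prod>k<q. ?W k g)" if "r < q" for r g
    unfolding c_def using that by (simp add: prod.remove[of "{..<q}" r])
  have "(\<integral>g. (\<Sum>r<q. lam * of_nat (length (l r)) * F g + T r g) +
      2 * (\<Sum>r<q. \<Sum>s\<in>{r<..<q}. M r s g) \<partial>\<mu>) =
    (\<integral>g. of_real \<beta> * lam * (\<Sum>p\<in>P. U p g) + (of_real \<beta>)\<^sup>2 * (\<Sum>p\<in>P. \<Sum>p'\<in>P. V p p' g) \<partial>\<mu>)"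
    (is "?L = ?R")
  proof -
    define S where "S g = of_real \<beta> * (\<Sum>p\<in>P. wilson_loop G \<rho> [(C p, \<epsilon> p)] g)" for g
    define m where "m r s g = total_merger G \<rho> I \<xi> (l r) (l s) g * (\<Prod>k\<in>{..<q} - {r, s}. ?W k g)"
      for r s g
    define t where "t r g = (lam * of_nat (length (l r)) * ?W r g + total_twisting G \<rho> I \<xi> (l r) g) * c r g"
      for r g
    define u where "u g = (\<Sum>p\<in>P. wilson_loop G \<rho> [(C p, \<epsilon> p)] g)" for g
    define v where "v g = (\<Sum>p\<in>P. \<Sum>p'\<in>P. total_merger G \<rho> I \<xi> [(C p, \<epsilon> p)] [(C p', \<epsilon> p')] g)"
      for g
    have "(\<Sum>r<q. lam * of_nat (length (l r)) * F g + T r g) = (\<Sum>r<q. t r g) * ?\<nu> g" for g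
      unfolding sum_distrib_right
      by (rule sum.cong[OF refl]) (simp add: F_def T_def t_def W[symmetric] algebra_simps)
    moreover have "(\<Sum>r<q. \<Sum>s\<in>{r<..<q}. M r s g) = (\<Sum>r<q. \<Sum>s\<in>{r<..<q}. m r s g) * ?\<nu> g" for g
      unfolding sum_distrib_right M_def m_def ..
    ultimately have "?L = (\<integral>g. ((\<Sum>r<q. t r g) + 2 * (\<Sum>r<q. \<Sum>s\<in>{r<..<q}. m r s g)) * exp (S g) / ?Z \<partial>\<mu>)"
      by (simp add: \<nu> S_def add_divide_distrib distrib_right mult.assoc)
    \<comment> \<open>The constant 1/Z is taken out of both integrals, which reduces the claim to
      \<open>wilson_loop_equation\<close>.\<close>
    also have "\<dots> = (\<integral>g. (\<Prod>k<q. ?W k g) * (of_real \<beta> * lam * u g + (of_real \<beta>)\<^sup>2 * v g) * exp (S g) / ?Z \<partial>\<mu>)"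
      unfolding integral_divide_zero t_def m_def c_def u_def v_def S_def
      by (rule arg_cong2[of _ _ _ _ "(/)", OF wilson_loop_equation[OF rep \<xi> casimir] refl])
        (use l assms(10) in auto)
    also have "\<dots> = ?R"
    proof -
      have "(\<Sum>p\<in>P. U p g) = u g * ((\<Prod>k<q. ?W k g) * ?\<nu> g)" for g
        unfolding U_def u_def sum_distrib_right by (simp add: mult.assoc)
      moreover have "(\<Sum>p\<in>P. \<Sum>p'\<in>P. V p p' g) = v g * ((\<Prod>k<q. ?W k g) * ?\<nu> g)" for g
        unfolding V_def v_def sum_distrib_right by (simp add: mult.assoc)
      ultimately show ?thesis
        by (intro Bochner_Integration.integral_cong refl)
          (simp add: \<nu> S_def add_divide_distrib algebra_simps)
    qed
    finally show ?thesis .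
  qed
  also have "?R = of_real \<beta> * lam * (\<Sum>p\<in>P. \<integral>g. U p g \<partial>\<mu>) +
      (of_real \<beta>)\<^sup>2 * (\<Sum>p\<in>P. \<Sum>p'\<in>P. \<integral>g. V p p' g \<partial>\<mu>)"
    using int by (simp add: Bochner_Integration.integral_add Bochner_Integration.integral_sum)
  also have "?L = (\<Sum>r<q. lam * of_nat (length (l r)) * (\<integral>g. F g \<partial>\<mu>) + (\<integral>g. T r g \<partial>\<mu>)) +
      2 * (\<Sum>r<q. \<Sum>s\<in>{r<..<q}. \<integral>g. M r s g \<partial>\<mu>)"
  proof -
    have T: "integrable \<mu> (\<lambda>g. lam * of_nat (length (l r)) * F g)" "integrable \<mu> (\<lambda>g. T r g)" if "r < q" for r
      using int that by simp_all
    have M: "integrable \<mu> (\<lambda>g. \<Sum>s\<in>{r<..<q}. M r s g)" if "r < q" for r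
      using that by (intro Bochner_Integration.integrable_sum) (simp add: int)
    have "?L = (\<integral>g. (\<Sum>r<q. lam * of_nat (length (l r)) * F g + T r g) \<partial>\<mu>) +
        2 * (\<integral>g. (\<Sum>r<q. \<Sum>s\<in>{r<..<q}. M r s g) \<partial>\<mu>)"
      by (subst Bochner_Integration.integral_add)
        (auto intro!: Bochner_Integration.integrable_sum Bochner_Integration.integrable_add T M)
    also have "(\<integral>g. (\<Sum>r<q. \<Sum>s\<in>{r<..<q}. M r s g) \<partial>\<mu>) = (\<Sum>r<q. \<integral>g. (\<Sum>s\<in>{r<..<q}. M r s g) \<partial>\<mu>)"
      by (intro Bochner_Integration.integral_sum M) simp
    also have "\<dots> = (\<Sum>r<q. \<Sum>s\<in>{r<..<q}. \<integral>g. M r s g \<partial>\<mu>)"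
      by (intro sum.cong refl Bochner_Integration.integral_sum) (simp add: int)
    also have "(\<integral>g. (\<Sum>r<q. lam * of_nat (length (l r)) * F g + T r g) \<partial>\<mu>) =
        (\<Sum>r<q. \<integral>g. lam * of_nat (length (l r)) * F g + T r g \<partial>\<mu>)"
      by (intro Bochner_Integration.integral_sum Bochner_Integration.integrable_add T) simp_all
    also have "\<dots> = (\<Sum>r<q. lam * of_nat (length (l r)) * (\<integral>g. F g \<partial>\<mu>) + (\<integral>g. T r g \<partial>\<mu>))"
      by (intro sum.cong refl) (simp add: T int)
    finally show ?thesis .
  qed
  \<comment> \<open>The Casimir terms on the left have the common factor \<open>lam\<close>; the
    merger and twisting terms change sides and sign.\<close>
  finally have "lam * (\<Sum>r<q. of_nat (length (l r)) * (\<integral>g. F g \<partial>\<mu>)) =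
      - 2 * (\<Sum>r<q. \<Sum>s\<in>{r<..<q}. \<integral>g. M r s g \<partial>\<mu>) - (\<Sum>r<q. \<integral>g. T r g \<partial>\<mu>) +
      of_real \<beta> * lam * (\<Sum>p\<in>P. \<integral>g. U p g \<partial>\<mu>) +
      (of_real \<beta>)\<^sup>2 * (\<Sum>p\<in>P. \<Sum>p'\<in>P. \<integral>g. V p p' g \<partial>\<mu>)"
    unfolding sum.distrib mult.assoc[of lam] sum_distrib_left[of lam, symmetric]
    by (simp add: algebra_simps)
  then show ?thesis unfolding F_def T_def M_def U_def V_def c_def .
qed

end
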